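(* Let $\mathbf{X}, \mathbf{Z}$ be computable metric spaces and $\mathbf{Y}$ a represented space. If $f : \mathbf{X} \times \mathbf{Y} \to \mathbf{Z}$ satisfies $f \leq_\mathrm{W} C_\mathbb{N}$, then the map $y \mapsto (x \mapsto f(x, y)) : \mathbf{Y} \to \mathcal{C}^{\mathcal{A}-pw}(\mathbf{X}, \mathbf{Z})$ is computable.
   Context: Work in computable analysis: a represented space is a set with a partial surjection $\delta :\subseteq \{0,1\}^\mathbb{N} \to X$; computable metric spaces carry their standard Cauchy representation. $\mathcal{A}(\mathbf{X})$ is the represented space of closed subsets (negative information: names of complements as open sets), $\mathcal{C}(\mathbf{A},\mathbf{Z})$ the represented space of continuous functions. The space $\mathcal{C}^{\mathcal{A}-pw}(\mathbf{X}, \mathbf{Z})$ of $\mathcal{A}$-piecewise continuous functions: a function $g : \mathbf{X} \to \mathbf{Z}$ is named by a sequence $(A_i, g_i)_{i \in \mathbb{N}}$ with $A_i \in \mathcal{A}(\mathbf{X})$, $g_i \in \mathcal{C}(\mathbf{A}_i, \mathbf{Z})$ (where $\mathbf{A}_i$ is the subspace on $A_i$), given computably in $i$, such that $X = \bigcup_i A_i$ and $g_i = g_{|A_i}$. Weihrauch reducibility: $f \leq_\mathrm{W} g$ iff there are computable $H, K :\subseteq \{0,1\}^\mathbb{N} \to \{0,1\}^\mathbb{N}$ such that for every realizer $G$ of $g$, $x \mapsto H(\langle x, GK(x)\rangle)$ realizes $f$. $C_\mathbb{N} :\subseteq \mathcal{A}(\mathbb{N}) \rightrightarrows \mathbb{N}$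 is closed choice on $\mathbb{N}$: given a nonempty closed (i.e. any, given by an enumeration of its complement) subset $A\subseteq\mathbb{N}$, output some element of $A$. *)

theory Defs
  imports "HOL-Analysis.Analysis" "HOL-Library.Nat_Bijection"
begin

section \<open>Computability on Cantor space\<close>

type_synonym cantor = "nat \<Rightarrow> bool"

text \<open>
  Partial recursive functions relative to an oracle in Cantor space. Programs are unary;
  several arguments are passed through the Cantor pairing function.
\<close>

datatype prog =
    PZero | PSucc | PFst | PSnd | POracle
  | PPair prog prog | PComp prog prog | PRec prog prog | PMu prog

inductive eval :: "cantor \<Rightarrow> prog \<Rightarrow> nat \<Rightarrow> nat \<Rightarrow> bool" for p :: cantor where
  eval_Zero: "eval p PZero n 0"
| eval_Succ: "eval p PSucc n (Suc n)"
| eval_Fst: "eval p PFst n (fst (prod_decode n))"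
| eval_Snd: "eval p PSnd n (snd (prod_decode n))"
| eval_Oracle: "eval p POracle n (of_bool (p n))"
| eval_Pair: "eval p a n x \<Longrightarrow> eval p b n y \<Longrightarrow> eval p (PPair a b) n (prod_encode (x, y))"
| eval_Comp: "eval p b n m \<Longrightarrow> eval p a m r \<Longrightarrow> eval p (PComp a b) n r"
| eval_Rec_0: "eval p a n r \<Longrightarrow> eval p (PRec a b) (prod_encode (n, 0)) r"
| eval_Rec_Suc:
    "eval p (PRec a b) (prod_encode (n, k)) r \<Longrightarrow>
     eval p b (prod_encode (n, prod_encode (k, r))) s \<Longrightarrow>
     eval p (PRec a b) (prod_encode (n, Suc k)) s"
| eval_Mu:
    "eval p a (prod_encode (n, k)) 0 \<Longrightarrow>
     (\<And>m. m < k \<Longrightarrow> \<exists>r. eval p a (prod_encode (n, m)) (Suc r)) \<Longrightarrow>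
     eval p (PMu a) n k"

primrec prog_code :: "prog \<Rightarrow> nat" where
  "prog_code PZero = 0"
| "prog_code PSucc = 1"
| "prog_code PFst = 2"
| "prog_code PSnd = 3"
| "prog_code POracle = 4"
| "prog_code (PPair a b) = 5 + 4 * prod_encode (prog_code a, prog_code b)"
| "prog_code (PComp a b) = 6 + 4 * prod_encode (prog_code a, prog_code b)"
| "prog_code (PRec a b) = 7 + 4 * prod_encode (prog_code a, prog_code b)"
| "prog_code (PMu a) = 8 + 4 * prog_code a"

text \<open>
  Turns a right-unique relation into a partial function. All relations it is applied to
  below are right-unique, see the uniqueness lemmas.
\<close>

definition partial_of :: "('a \<Rightarrow> 'b \<Rightarrow> bool) \<Rightarrow> 'a \<Rightarrow> 'b option" where
  "partial_of R a = (if \<exists>!b. R a b then Some (THE b. R a b) else None)"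

definition outputs :: "prog \<Rightarrow> cantor \<Rightarrow> cantor \<Rightarrow> bool" where
  "outputs e p q \<longleftrightarrow> (\<forall>n. eval p e n (of_bool (q n)))"

definition Phi :: "prog \<Rightarrow> cantor \<Rightarrow> cantor option" where
  "Phi e = partial_of (outputs e)"

definition computable :: "(cantor \<Rightarrow> cantor option) \<Rightarrow> bool" where
  "computable F \<longleftrightarrow> (\<exists>e. F \<subseteq>\<^sub>m Phi e)"

definition computable_nat :: "(nat \<Rightarrow> nat) \<Rightarrow> bool" where
  "computable_nat f \<longleftrightarrow> (\<exists>e. \<forall>n. eval (\<lambda>_. False) e n (f n))"

definition rat_of_code :: "nat \<Rightarrow> rat" where
  "rat_of_code c = (case prod_decode c of (a, t) \<Rightarrow> case prod_decode t of (b, k) \<Rightarrow>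
     (of_nat a - of_nat b) / of_nat (Suc k))"

definition computable_real_seq :: "(nat \<Rightarrow> real) \<Rightarrow> bool" where
  "computable_real_seq x \<longleftrightarrow>
     (\<exists>f. computable_nat f \<and>
        (\<forall>n k. \<bar>x n - of_rat (rat_of_code (f (prod_encode (n, k))))\<bar> \<le> (1/2) ^ k))"


section \<open>Represented spaces\<close>

text \<open>
  A represented space is given by its representation \<open>\<delta>\<close>, a partial function on Cantor space;
  its underlying set is \<open>ran \<delta>\<close>, so that surjectivity is built in.
\<close>

type_synonym 'a repr = "cantor \<Rightarrow> 'a option"

definition pair :: "cantor \<Rightarrow> cantor \<Rightarrow> cantor" where
  "pair p q n = (if even n then p (n div 2) else q (n div 2))"

definition pfst :: "cantor \<Rightarrow> cantor" where
  "pfst p n = p (2 * n)"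

definition psnd :: "cantor \<Rightarrow> cantor" where
  "psnd p n = p (2 * n + 1)"

definition proj :: "cantor \<Rightarrow> nat \<Rightarrow> cantor" where
  "proj p i j = p (prod_encode (i, j))"

text \<open>The sequence \<open>0\<^sup>n 1 q\<close>:\<close>

definition tagged :: "nat \<Rightarrow> cantor \<Rightarrow> cantor" where
  "tagged n q k = (if k < n then False else if k = n then True else q (k - Suc n))"

text \<open>
  A multivalued partial function is a set-valued function whose domain consists of the
  points with nonempty value.
\<close>

definition realizes ::
    "'a repr \<Rightarrow> 'b repr \<Rightarrow> ('a \<Rightarrow> 'b set) \<Rightarrow> (cantor \<Rightarrow> cantor option) \<Rightarrow> bool" where
  "realizes \<delta>A \<delta>B f F \<longleftrightarrow>
     (\<forall>p x. \<delta>A p = Some x \<and> f x \<noteq> {} \<longrightarrow> (\<exists>q y. F p = Some q \<and> \<delta>B q = Some y \<and> y \<in> f x))"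

definition computable_map :: "'a repr \<Rightarrow> 'b repr \<Rightarrow> ('a \<Rightarrow> 'b) \<Rightarrow> bool" where
  "computable_map \<delta>A \<delta>B f \<longleftrightarrow> (\<exists>F. computable F \<and> realizes \<delta>A \<delta>B (\<lambda>x. {f x}) F)"

definition weihrauch_le ::
    "'a repr \<Rightarrow> 'b repr \<Rightarrow> ('a \<Rightarrow> 'b set) \<Rightarrow> 'c repr \<Rightarrow> 'd repr \<Rightarrow> ('c \<Rightarrow> 'd set) \<Rightarrow> bool" where
  "weihrauch_le \<delta>A \<delta>B f \<delta>C \<delta>D g \<longleftrightarrow>
     (\<exists>H K. computable H \<and> computable K \<and>
        (\<forall>G. realizes \<delta>C \<delta>D g G \<longrightarrow>
           realizes \<delta>A \<delta>B f
             (\<lambda>p. Option.bind (K p) (\<lambda>r. Option.bind (G r) (\<lambda>s. H (pair p s))))))"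

definition prod_rep :: "'a repr \<Rightarrow> 'b repr \<Rightarrow> ('a \<times> 'b) repr" where
  "prod_rep \<delta>A \<delta>B p =
     Option.bind (\<delta>A (pfst p)) (\<lambda>x. Option.bind (\<delta>B (psnd p)) (\<lambda>y. Some (x, y)))"

definition sub_rep :: "'a repr \<Rightarrow> 'a set \<Rightarrow> 'a repr" where
  "sub_rep \<delta> A p = Option.bind (\<delta> p) (\<lambda>x. if x \<in> A then Some x else None)"

text \<open>The number \<open>n\<close> has the single name \<open>0\<^sup>n 1 0\<^sup>\<omega>\<close>.\<close>

definition nat_name :: "cantor \<Rightarrow> nat \<Rightarrow> bool" where
  "nat_name p n \<longleftrightarrow> p = tagged n (\<lambda>_. False)"

definition nat_rep :: "nat repr" where
  "nat_rep = partial_of nat_name"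

definition seq_rep :: "'a repr \<Rightarrow> (nat \<Rightarrow> 'a) repr" where
  "seq_rep \<delta> p =
     (if \<forall>i. \<delta> (proj p i) \<noteq> None then Some (\<lambda>i. the (\<delta> (proj p i))) else None)"

definition sierpinski_rep :: "bool repr" where
  "sierpinski_rep p = Some (\<exists>n. p n)"


subsection \<open>Function spaces and hyperspaces\<close>

text \<open>
  \<open>0\<^sup>n 1 q\<close> names \<open>g\<close> if the \<open>n\<close>-th oracle program with parameter \<open>q\<close> realizes \<open>g\<close>.
  As every continuous partial function on Cantor space has a continuous extension computed in
  this way, the functions that have a name are the continuous ones.
  Functions on a represented space are taken to be \<open>undefined\<close> outside its underlying set.
\<close>

definition fun_name :: "'a repr \<Rightarrow> 'b repr \<Rightarrow> cantor \<Rightarrow> ('a \<Rightarrow> 'b) \<Rightarrow> bool" where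
  "fun_name \<delta>A \<delta>B p g \<longleftrightarrow>
     g \<in> ran \<delta>A \<rightarrow>\<^sub>E ran \<delta>B \<and>
     (\<exists>e q. p = tagged (prog_code e) q \<and>
        realizes \<delta>A \<delta>B (\<lambda>x. {g x}) (\<lambda>r. Phi e (pair q r)))"

definition fun_rep :: "'a repr \<Rightarrow> 'b repr \<Rightarrow> ('a \<Rightarrow> 'b) repr" where
  "fun_rep \<delta>A \<delta>B = partial_of (fun_name \<delta>A \<delta>B)"

text \<open>
  Open sets are named as continuous maps into Sierpinski space, closed sets by names of
  their complements.
\<close>

definition open_rep :: "'a repr \<Rightarrow> 'a set repr" where
  "open_rep \<delta> p = map_option (\<lambda>g. {x \<in> ran \<delta>. g x}) (fun_rep \<delta> sierpinski_rep p)"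

definition closed_rep :: "'a repr \<Rightarrow> 'a set repr" where
  "closed_rep \<delta> p = map_option (\<lambda>U. ran \<delta> - U) (open_rep \<delta> p)"

text \<open>
  Subsets of \<open>\<nat>\<close> by enumerations of the complement: a value \<open>n + 1\<close> removes \<open>n\<close>,
  the value \<open>0\<close> conveys nothing.
\<close>

definition closed_nat_rep :: "nat set repr" where
  "closed_nat_rep p = map_option (\<lambda>u. {n. \<forall>k. u k \<noteq> Suc n}) (seq_rep nat_rep p)"

text \<open>Any element of \<open>A\<close> is a valid answer; the domain consists of the nonempty sets.\<close>

definition closed_choice_nat :: "nat set \<Rightarrow> nat set" where
  "closed_choice_nat A = A"

definition piecewise_name :: "'a repr \<Rightarrow> 'b repr \<Rightarrow> cantor \<Rightarrow> ('a \<Rightarrow> 'b) \<Rightarrow> bool" where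
  "piecewise_name \<delta>A \<delta>B p g \<longleftrightarrow>
     g \<in> ran \<delta>A \<rightarrow>\<^sub>E ran \<delta>B \<and>
     (\<exists>A h. (\<forall>i. closed_rep \<delta>A (pfst (proj p i)) = Some (A i)) \<and>
        (\<forall>i. fun_rep (sub_rep \<delta>A (A i)) \<delta>B (psnd (proj p i)) = Some (h i)) \<and>
        ran \<delta>A = (\<Union>i. A i) \<and>
        (\<forall>i. h i = restrict g (A i)))"

definition piecewise_rep :: "'a repr \<Rightarrow> 'b repr \<Rightarrow> ('a \<Rightarrow> 'b) repr" where
  "piecewise_rep \<delta>A \<delta>B = partial_of (piecewise_name \<delta>A \<delta>B)"


subsection \<open>Computable metric spaces\<close>

locale computable_metric_space = Metric_space M d
  for M :: "'a set" and d :: "'a \<Rightarrow> 'a \<Rightarrow> real" +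
  fixes \<alpha> :: "nat \<Rightarrow> 'a"
  assumes points: "range \<alpha> \<subseteq> M"
    and dense: "mtopology closure_of range \<alpha> = M"
    and computable_dist:
      "computable_real_seq (\<lambda>n. case prod_decode n of (i, j) \<Rightarrow> d (\<alpha> i) (\<alpha> j))"

definition cauchy_name ::
    "'a set \<Rightarrow> ('a \<Rightarrow> 'a \<Rightarrow> real) \<Rightarrow> (nat \<Rightarrow> 'a) \<Rightarrow> cantor \<Rightarrow> 'a \<Rightarrow> bool" where
  "cauchy_name M d \<alpha> p x \<longleftrightarrow>
     (\<exists>u. seq_rep nat_rep p = Some u \<and>
        (\<forall>i j. i < j \<longrightarrow> d (\<alpha> (u i)) (\<alpha> (u j)) \<le> (1/2) ^ i) \<and>
        limitin (Metric_space.mtopology M d) (\<lambda>i. \<alpha> (u i)) x sequentially)"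

definition cauchy_rep :: "'a set \<Rightarrow> ('a \<Rightarrow> 'a \<Rightarrow> real) \<Rightarrow> (nat \<Rightarrow> 'a) \<Rightarrow> 'a repr" where
  "cauchy_rep M d \<alpha> = partial_of (cauchy_name M d \<alpha>)"


section \<open>Well-definedness\<close>

lemma partial_of_eq_Some_iff:
  assumes "\<And>b b'. R a b \<Longrightarrow> R a b' \<Longrightarrow> b = b'"
  shows "partial_of R a = Some b \<longleftrightarrow> R a b"
proof
  assume "partial_of R a = Some b"
  then have "\<exists>!b. R a b" "b = (THE b. R a b)"
    by (auto simp: partial_of_def split: if_splits)
  then show "R a b" by (metis theI')
next
  assume "R a b"
  then have "\<exists>!b. R a b" "(THE b. R a b) = b" using assms by blast+
  then show "partial_of R a = Some b" by (simp add: partial_of_def)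
qed

inductive_cases eval_elims:
  "eval p PZero n r" "eval p PSucc n r" "eval p PFst n r" "eval p PSnd n r"
  "eval p POracle n r" "eval p (PPair a b) n r" "eval p (PComp a b) n r"
  "eval p (PMu a) n r"

inductive_cases eval_RecE: "eval p (PRec a b) n r"

lemma eval_unique: "eval p e n r \<Longrightarrow> eval p e n s \<Longrightarrow> r = s"
proof (induction arbitrary: s rule: eval.induct)
  case (eval_Mu a n k)
  from eval_Mu.prems have 1: "eval p a (prod_encode (n, s)) 0"
    and 2: "\<And>m. m < s \<Longrightarrow> \<exists>r. eval p a (prod_encode (n, m)) (Suc r)"
    by (auto elim: eval_elims)
  have "\<not> s < k" using eval_Mu.IH(2)[of s] 1 by auto
  moreover have "\<not> k < s" using eval_Mu.IH(1) 2 by blast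
  ultimately show ?case by simp
next
  case (eval_Rec_0 a n r b)
  from eval_Rec_0.prems show ?case
    by (rule eval_RecE) (auto simp: eval_Rec_0.IH)
next
  case (eval_Rec_Suc a b n k r s t)
  from eval_Rec_Suc.prems show ?case
  proof (rule eval_RecE)
    fix n' k' r'
    assume eq: "prod_encode (n, Suc k) = prod_encode (n', Suc k')"
      and r': "eval p (PRec a b) (prod_encode (n', k')) r'"
      and t: "eval p b (prod_encode (n', prod_encode (k', r'))) t"
    from eq have "n' = n" "k' = k" by simp_all
    then show "s = t" using eval_Rec_Suc.IH r' t by metis
  qed simp
next
  case (eval_Pair a n x b y)
  from eval_Pair.prems show ?case
    by (rule eval_elims) (use eval_Pair.IH in auto)
next
  case (eval_Comp b n m a r)
  from eval_Comp.prems show ?case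
    by (rule eval_elims) (use eval_Comp.IH in auto)
qed (auto elim: eval_elims)

lemma Phi_eq_Some_iff: "Phi e p = Some q \<longleftrightarrow> outputs e p q"
  unfolding Phi_def
proof (rule partial_of_eq_Some_iff)
  fix q q' assume "outputs e p q" "outputs e p q'"
  then have eq: "of_bool (q n) = (of_bool (q' n) :: nat)" for n
    unfolding outputs_def by (blast intro: eval_unique)
  have "q n = q' n" for n using eq[of n] by (cases "q n"; cases "q' n") simp_all
  then show "q = q'" by (rule ext)
qed

lemma bij_prog_code: "bij prog_code"
proof (rule bijI)
  have mod4:
    "4 * m \<noteq> Suc (4 * n)" "Suc (4 * n) \<noteq> 4 * m"
    "4 * m \<noteq> Suc (Suc (4 * n))" "Suc (Suc (4 * n)) \<noteq> 4 * m"
    "4 * m \<noteq> 3 + 4 * n" "3 + 4 * n \<noteq> 4 * m" for m n :: nat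
    by presburger+
  have "prog_code a = prog_code b \<Longrightarrow> a = b" for a b
    by (induction a arbitrary: b; case_tac b; simp add: mod4)
  then show "inj prog_code" by (rule injI)
  have "\<exists>e. prog_code e = n" for n
  proof (induction n rule: less_induct)
    case (less n)
    show ?case
    proof (cases "n < 5")
      case True
      then have "n = 0 \<or> n = 1 \<or> n = 2 \<or> n = 3 \<or> n = 4" by auto
      then show ?thesis using prog_code.simps(1-5) by metis
    next
      case False
      define m where "m = (n - 5) div 4"
      obtain i j where ij: "m = prod_encode (i, j)"
        by (metis prod_decode_inverse surj_pair)
      have "i \<le> m" "j \<le> m" unfolding ij by (rule le_prod_encode_1 le_prod_encode_2)+
      moreover have "m < n" using False unfolding m_def by presburger
      ultimately have lt: "i < n" "j < n" "m < n" by auto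
      obtain a b c where abc: "prog_code a = i" "prog_code b = j" "prog_code c = m"
        using less.IH[OF lt(1)] less.IH[OF lt(2)] less.IH[OF lt(3)] by auto
      have "n = 5 + 4 * m \<or> n = 6 + 4 * m \<or> n = 7 + 4 * m \<or> n = 8 + 4 * m"
        using False unfolding m_def by presburger
      then show ?thesis using abc ij prog_code.simps(6-9) by metis
    qed
  qed
  then show "surj prog_code" by (metis surjI)
qed

lemma tagged_eq_iff: "tagged m p = tagged n q \<longleftrightarrow> m = n \<and> p = q"
proof
  assume eq: "tagged m p = tagged n q"
  have "\<not> m < n" using fun_cong[OF eq, of m] by (auto simp: tagged_def)
  moreover have "\<not> n < m" using fun_cong[OF eq, of n] by (auto simp: tagged_def)
  ultimately have "m = n" by simp
  moreover have "p k = q k" for k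
    using fun_cong[OF eq, of "k + Suc n"] \<open>m = n\<close> by (auto simp: tagged_def)
  ultimately show "m = n \<and> p = q" by auto
qed simp

lemma nat_rep_eq_Some_iff: "nat_rep p = Some n \<longleftrightarrow> nat_name p n"
  unfolding nat_rep_def
  by (rule partial_of_eq_Some_iff) (auto simp: nat_name_def tagged_eq_iff)

lemma fun_rep_eq_Some_iff: "fun_rep \<delta>A \<delta>B p = Some g \<longleftrightarrow> fun_name \<delta>A \<delta>B p g"
  unfolding fun_rep_def
proof (rule partial_of_eq_Some_iff)
  fix g h assume g: "fun_name \<delta>A \<delta>B p g" and h: "fun_name \<delta>A \<delta>B p h"
  obtain e q where p: "p = tagged (prog_code e) q"
    and G: "realizes \<delta>A \<delta>B (\<lambda>x. {g x}) (\<lambda>r. Phi e (pair q r))"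
    using g by (auto simp: fun_name_def)
  obtain e' q' where p': "p = tagged (prog_code e') q'"
    and H: "realizes \<delta>A \<delta>B (\<lambda>x. {h x}) (\<lambda>r. Phi e' (pair q' r))"
    using h by (auto simp: fun_name_def)
  have "e' = e" "q' = q"
    using p p' bij_prog_code by (auto simp: tagged_eq_iff bij_def inj_def)
  have "g x = h x" if "x \<in> ran \<delta>A" for x
  proof -
    from that obtain r where "\<delta>A r = Some x" by (auto simp: ran_def)
    then show ?thesis
      using G H unfolding \<open>e' = e\<close> \<open>q' = q\<close> by (fastforce simp: realizes_def)
  qed
  moreover have "g \<in> extensional (ran \<delta>A)" "h \<in> extensional (ran \<delta>A)"
    using g h by (auto simp: fun_name_def PiE_def)
  ultimately show "g = h" by (meson extensionalityI)
qed

lemma piecewise_rep_eq_Some_iff: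
  "piecewise_rep \<delta>A \<delta>B p = Some g \<longleftrightarrow> piecewise_name \<delta>A \<delta>B p g"
  unfolding piecewise_rep_def
proof (rule partial_of_eq_Some_iff)
  fix g h assume g: "piecewise_name \<delta>A \<delta>B p g" and h: "piecewise_name \<delta>A \<delta>B p h"
  obtain A where A: "\<And>i. closed_rep \<delta>A (pfst (proj p i)) = Some (A i)"
      "\<And>i. fun_rep (sub_rep \<delta>A (A i)) \<delta>B (psnd (proj p i)) = Some (restrict g (A i))"
      "ran \<delta>A = (\<Union>i. A i)"
    using g unfolding piecewise_name_def by metis
  obtain B where B: "\<And>i. closed_rep \<delta>A (pfst (proj p i)) = Some (B i)"
      "\<And>i. fun_rep (sub_rep \<delta>A (B i)) \<delta>B (psnd (proj p i)) = Some (restrict h (B i))"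
    using h unfolding piecewise_name_def by metis
  have "B i = A i" for i using A(1)[of i] B(1)[of i] by simp
  then have "restrict g (A i) = restrict h (A i)" for i
    using A(2)[of i] B(2)[of i] by simp
  then have "g x = h x" if "x \<in> ran \<delta>A" for x
    using that A(3) by (metis UN_E restrict_apply')
  moreover have "g \<in> extensional (ran \<delta>A)" "h \<in> extensional (ran \<delta>A)"
    using g h by (auto simp: piecewise_name_def PiE_def)
  ultimately show "g = h" by (meson extensionalityI)
qed

context computable_metric_space
begin

lemma cauchy_rep_eq_Some_iff: "cauchy_rep M d \<alpha> p = Some x \<longleftrightarrow> cauchy_name M d \<alpha> p x"
  unfolding cauchy_rep_def
proof (rule partial_of_eq_Some_iff)
  fix x y assume "cauchy_name M d \<alpha> p x" "cauchy_name M d \<alpha> p y"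
  then show "x = y"
    by (auto simp: cauchy_name_def
        intro: limitin_metric_unique[where F = sequentially])
qed

lemma ran_cauchy_rep: "ran (cauchy_rep M d \<alpha>) = M"
proof
  show "ran (cauchy_rep M d \<alpha>) \<subseteq> M"
    by (auto simp: ran_def cauchy_rep_eq_Some_iff cauchy_name_def limitin_metric)
  show "M \<subseteq> ran (cauchy_rep M d \<alpha>)"
  proof
    fix x assume x: "x \<in> M"
    have "\<exists>n. d (\<alpha> n) x < (1/2) ^ Suc i" for i :: nat
    proof -
      have "x \<in> mtopology closure_of range \<alpha>" using x dense by simp
      then have "\<And>r. r > 0 \<Longrightarrow> \<exists>y \<in> range \<alpha>. y \<in> mball x r"
        unfolding metric_closure_of by blast
      from this[of "(1/2) ^ Suc i"] obtain n where "\<alpha> n \<in> mball x ((1/2) ^ Suc i)"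
        by (auto simp del: power_Suc in_mball)
      then have "d (\<alpha> n) x < (1/2) ^ Suc i" by (simp add: commute del: power_Suc)
      then show ?thesis by blast
    qed
    then obtain u where u: "\<And>i. d (\<alpha> (u i)) x < (1/2) ^ Suc i" by metis
    have in_M: "\<alpha> n \<in> M" for n using points by auto
    define p :: cantor where
      "p = (\<lambda>n. case prod_decode n of (i, j) \<Rightarrow> tagged (u i) (\<lambda>_. False) j)"
    have "proj p i = tagged (u i) (\<lambda>_. False)" for i
      by (auto simp: proj_def p_def)
    then have "nat_rep (proj p i) = Some (u i)" for i
      by (simp add: nat_rep_eq_Some_iff nat_name_def)
    then have "seq_rep nat_rep p = Some u" by (simp add: seq_rep_def)
    moreover have "d (\<alpha> (u i)) (\<alpha> (u j)) \<le> (1/2) ^ i" if "i < j" for i j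
    proof -
      have "d (\<alpha> (u i)) (\<alpha> (u j)) \<le> d (\<alpha> (u i)) x + d (\<alpha> (u j)) x"
        using triangle''[of "\<alpha> (u i)" x "\<alpha> (u j)"] triangle[of "\<alpha> (u i)" x "\<alpha> (u j)"]
          in_M x by (simp add: commute)
      also have "\<dots> \<le> (1/2) ^ Suc i + (1/2) ^ Suc j"
        using u[of i] u[of j] by simp
      also have "(1/2) ^ Suc j \<le> (1/2 :: real) ^ Suc i"
        using that by (intro power_decreasing) auto
      finally show ?thesis by simp
    qed
    moreover have "limitin mtopology (\<lambda>i. \<alpha> (u i)) x sequentially"
    proof -
      have "(\<lambda>i. (1/2 :: real) ^ Suc i) \<longlonglongrightarrow> 0"
        by (rule LIMSEQ_Suc) (simp add: LIMSEQ_power_zero)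
      then have "(\<lambda>i. d (\<alpha> (u i)) x) \<longlonglongrightarrow> 0"
        by (rule tendsto_sandwich[OF _ _ tendsto_const, rotated 2])
          (use u in \<open>auto intro!: eventuallyI less_imp_le simp del: power_Suc\<close>)
      then show ?thesis using in_M x by (simp add: limitin_metric_dist_null)
    qed
    ultimately have "cauchy_name M d \<alpha> p x" by (auto simp: cauchy_name_def)
    then show "x \<in> ran (cauchy_rep M d \<alpha>)"
      by (auto simp: ran_def cauchy_rep_eq_Some_iff)
  qed
qed

end

end

theory Submission
  imports Defs
begin

text \<open>
  Let \<open>K\<close> and \<open>H\<close> witness the reduction and fix a name \<open>q\<close> of \<open>y\<close>. A number \<open>n\<close> and a
  finite word \<open>w\<close> determine the piece of all \<open>x\<close> such that \<open>w\<close> is compatible with \<open>x\<close> and,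
  for every sufficiently fast name \<open>p\<close> of \<open>x\<close> extending \<open>w\<close>, the computation of \<open>K\<close> on
  \<open>\<langle>p, q\<rangle>\<close> never removes \<open>n\<close>. Membership can be refuted by a finite computation on a prefix of
  such a name. On the piece, a name of \<open>x\<close> is computably turned into one that extends \<open>w\<close>, for
  which \<open>n\<close> is a correct answer of closed choice, so that \<open>H\<close> yields \<open>f (x, y)\<close>. By the Baire
  category theorem on the set of fast names of \<open>x\<close>, every \<open>x\<close> lies in some piece.
\<close>

section \<open>Functions computable relative to an oracle\<close>

text \<open>One program must serve all oracles in \<open>S\<close>; membership in \<open>S\<close>
  is a promise under which unbounded searches terminate.\<close>

definition oracle_computable :: "cantor set \<Rightarrow> (cantor \<Rightarrow> nat \<Rightarrow> nat) \<Rightarrow> bool" where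
  "oracle_computable S F \<longleftrightarrow> (\<exists>e. \<forall>p\<in>S. \<forall>n. eval p e n (F p n))"

abbreviation oracle_decidable :: "cantor set \<Rightarrow> (cantor \<Rightarrow> nat \<Rightarrow> bool) \<Rightarrow> bool" where
  "oracle_decidable S P \<equiv> oracle_computable S (\<lambda>p n. of_bool (P p n))"

abbreviation cfst :: "nat \<Rightarrow> nat" where "cfst n \<equiv> fst (prod_decode n)"

abbreviation csnd :: "nat \<Rightarrow> nat" where "csnd n \<equiv> snd (prod_decode n)"

lemma oracle_computableI: "(\<And>p n. p \<in> S \<Longrightarrow> eval p e n (F p n)) \<Longrightarrow> oracle_computable S F"
  unfolding oracle_computable_def by blast

lemma oracle_computable_cong:
  "oracle_computable S F \<Longrightarrow> (\<And>p n. p \<in> S \<Longrightarrow> F p n = G p n) \<Longrightarrow> oracle_computable S G"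
  unfolding oracle_computable_def by metis

named_theorems oracle_computable_intros

lemma oracle_computable_comp:
  assumes "oracle_computable S F" "oracle_computable S G"
  shows "oracle_computable S (\<lambda>p n. F p (G p n))"
proof -
  obtain a b where "\<forall>p\<in>S. \<forall>n. eval p a n (F p n)" "\<forall>p\<in>S. \<forall>n. eval p b n (G p n)"
    using assms unfolding oracle_computable_def by blast
  then show ?thesis by (intro oracle_computableI[of _ "PComp a b"]) (blast intro: eval_Comp)
qed

lemma oracle_computable_Suc [oracle_computable_intros]:
  "oracle_computable S F \<Longrightarrow> oracle_computable S (\<lambda>p n. Suc (F p n))"
  by (rule oracle_computable_comp[of S "\<lambda>p. Suc"], rule oracle_computableI, rule eval_Succ)

lemma oracle_computable_const [oracle_computable_intros]: "oracle_computable S (\<lambda>p n. c)"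
proof (induction c)
  case 0
  show ?case by (rule oracle_computableI, rule eval_Zero)
next
  case (Suc c)
  then show ?case by (rule oracle_computable_Suc)
qed

lemma oracle_computable_pair [oracle_computable_intros]:
  assumes "oracle_computable S F" "oracle_computable S G"
  shows "oracle_computable S (\<lambda>p n. prod_encode (F p n, G p n))"
proof -
  obtain a b where "\<forall>p\<in>S. \<forall>n. eval p a n (F p n)" "\<forall>p\<in>S. \<forall>n. eval p b n (G p n)"
    using assms unfolding oracle_computable_def by blast
  then show ?thesis by (intro oracle_computableI[of _ "PPair a b"]) (blast intro: eval_Pair)
qed

lemma oracle_computable_fst [oracle_computable_intros]:
  "oracle_computable S F \<Longrightarrow> oracle_computable S (\<lambda>p n. cfst (F p n))"
  by (rule oracle_computable_comp[of S "\<lambda>p n. cfst n"], rule oracle_computableI, rule eval_Fst)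

lemma oracle_computable_snd [oracle_computable_intros]:
  "oracle_computable S F \<Longrightarrow> oracle_computable S (\<lambda>p n. csnd (F p n))"
  by (rule oracle_computable_comp[of S "\<lambda>p n. csnd n"], rule oracle_computableI, rule eval_Snd)

text \<open>No primitive program is the identity; taking a code apart and pairing it again gives
  one.\<close>

lemma oracle_computable_id [oracle_computable_intros]: "oracle_computable S (\<lambda>p n. n)"
proof -
  have "oracle_computable S (\<lambda>p n. prod_encode (cfst n, csnd n))"
    by (intro oracle_computableI[of _ "PPair PFst PSnd"] eval_Pair eval_Fst eval_Snd)
  then show ?thesis by simp
qed

lemma oracle_computable_oracle [oracle_computable_intros]:
  "oracle_computable S F \<Longrightarrow> oracle_decidable S (\<lambda>p n. p (F p n))"
  by (rule oracle_computable_comp[of S "\<lambda>p n. of_bool (p n)"], rule oracle_computableI,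
      rule eval_Oracle)

text \<open>\<open>PRec\<close> hands parameter, counter and previous value to the step program as
  one nested pair, hence the decoded form of \<open>B\<close>.\<close>

lemma oracle_computable_rec [oracle_computable_intros]:
  assumes "oracle_computable S A"
    and "oracle_computable S (\<lambda>p z. B p (cfst z) (cfst (csnd z)) (csnd (csnd z)))"
    and N: "oracle_computable S N"
  shows "oracle_computable S (\<lambda>p n. rec_nat (A p n) (B p n) (N p n))"
proof -
  obtain a b where a: "\<And>p n. p \<in> S \<Longrightarrow> eval p a n (A p n)"
    and b: "\<And>p z. p \<in> S \<Longrightarrow> eval p b z (B p (cfst z) (cfst (csnd z)) (csnd (csnd z)))"
    using assms(1,2) unfolding oracle_computable_def by blast
  have "eval p (PRec a b) (prod_encode (n, k)) (rec_nat (A p n) (B p n) k)"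
    if "p \<in> S" for p n k
  proof (induction k)
    case 0
    show ?case using a[OF that] by (auto intro: eval_Rec_0)
  next
    case (Suc k)
    show ?case
      using eval_Rec_Suc[OF Suc b[OF that]] by simp
  qed
  then have "oracle_computable S
      (\<lambda>p z. rec_nat (A p (cfst z)) (B p (cfst z)) (csnd z))"
    by (intro oracle_computableI[of _ "PRec a b"]) (metis prod.collapse prod_decode_inverse)
  from oracle_computable_comp[OF this oracle_computable_pair[OF oracle_computable_id N]]
  show ?thesis by simp
qed

section \<open>Closure under arithmetic\<close>

lemma oracle_computable_pred [oracle_computable_intros]:
  assumes "oracle_computable S F"
  shows "oracle_computable S (\<lambda>p n. F p n - 1)"
proof -
  have "oracle_computable S (\<lambda>p n. rec_nat 0 (\<lambda>k r. k) (F p n))"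
    by (intro oracle_computable_intros assms)
  moreover have "rec_nat 0 (\<lambda>k r. k) m = m - 1" for m :: nat by (cases m) auto
  ultimately show ?thesis by simp
qed

lemma oracle_computable_add [oracle_computable_intros]:
  assumes "oracle_computable S F" "oracle_computable S G"
  shows "oracle_computable S (\<lambda>p n. F p n + G p n)"
proof -
  have "oracle_computable S (\<lambda>p n. rec_nat (F p n) (\<lambda>k r. Suc r) (G p n))"
    by (intro oracle_computable_intros assms)
  moreover have "rec_nat a (\<lambda>k r. Suc r) b = a + b" for a b by (induction b) auto
  ultimately show ?thesis by simp
qed

lemma oracle_computable_diff [oracle_computable_intros]:
  assumes "oracle_computable S F" "oracle_computable S G"
  shows "oracle_computable S (\<lambda>p n. F p n - G p n)"
proof -
  have "oracle_computable S (\<lambda>p n. rec_nat (F p n) (\<lambda>k r. r - 1) (G p n))"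
    by (intro oracle_computable_intros assms)
  moreover have "rec_nat a (\<lambda>k r. r - 1) b = a - b" for a b :: nat by (induction b) auto
  ultimately show ?thesis by simp
qed

lemma oracle_computable_mult [oracle_computable_intros]:
  assumes "oracle_computable S F" "oracle_computable S G"
  shows "oracle_computable S (\<lambda>p n. F p n * G p n)"
proof -
  have "oracle_computable S (\<lambda>p n. rec_nat 0 (\<lambda>k r. r + F p n) (G p n))"
    by (intro oracle_computable_intros assms oracle_computable_comp[OF assms(1)])
  moreover have "rec_nat 0 (\<lambda>k r. r + a) b = a * b" for a b :: nat by (induction b) auto
  ultimately show ?thesis by simp
qed

lemma oracle_computable_power [oracle_computable_intros]:
  assumes "oracle_computable S F" "oracle_computable S G"
  shows "oracle_computable S (\<lambda>p n. F p n ^ G p n)"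
proof -
  have "oracle_computable S (\<lambda>p n. rec_nat 1 (\<lambda>k r. r * F p n) (G p n))"
    by (intro oracle_computable_intros assms oracle_computable_comp[OF assms(1)])
  moreover have "rec_nat 1 (\<lambda>k r. r * a) b = a ^ b" for a b :: nat by (induction b) auto
  ultimately show ?thesis by simp
qed

section \<open>Decidable predicates, case distinctions and searches\<close>

lemma oracle_decidable_not [oracle_computable_intros]:
  assumes "oracle_decidable S P"
  shows "oracle_decidable S (\<lambda>p n. \<not> P p n)"
proof -
  have "oracle_computable S (\<lambda>p n. 1 - of_bool (P p n))"
    by (intro oracle_computable_intros assms)
  then show ?thesis by (rule oracle_computable_cong) auto
qed

lemma oracle_decidable_conj [oracle_computable_intros]:
  assumes "oracle_decidable S P" "oracle_decidable S Q"
  shows "oracle_decidable S (\<lambda>p n. P p n \<and> Q p n)"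
  unfolding of_bool_conj by (intro oracle_computable_intros assms)

lemma oracle_decidable_disj [oracle_computable_intros]:
  assumes "oracle_decidable S P" "oracle_decidable S Q"
  shows "oracle_decidable S (\<lambda>p n. P p n \<or> Q p n)"
proof -
  have "oracle_decidable S (\<lambda>p n. \<not> (\<not> P p n \<and> \<not> Q p n))"
    by (intro oracle_computable_intros assms)
  then show ?thesis by simp
qed

lemma oracle_decidable_imp [oracle_computable_intros]:
  assumes "oracle_decidable S P" "oracle_decidable S Q"
  shows "oracle_decidable S (\<lambda>p n. P p n \<longrightarrow> Q p n)"
  unfolding imp_conv_disj by (intro oracle_computable_intros assms)

lemma oracle_decidable_less [oracle_computable_intros]:
  assumes "oracle_computable S F" "oracle_computable S G"
  shows "oracle_decidable S (\<lambda>p n. F p n < G p n)"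
proof -
  have "oracle_computable S (\<lambda>p n. 1 - (1 - (G p n - F p n)))"
    by (intro oracle_computable_intros assms)
  then show ?thesis by (rule oracle_computable_cong) auto
qed

lemma oracle_decidable_le [oracle_computable_intros]:
  assumes "oracle_computable S F" "oracle_computable S G"
  shows "oracle_decidable S (\<lambda>p n. F p n \<le> G p n)"
  unfolding not_less[symmetric] by (intro oracle_computable_intros assms)

lemma oracle_decidable_eq [oracle_computable_intros]:
  assumes "oracle_computable S F" "oracle_computable S G"
  shows "oracle_decidable S (\<lambda>p n. F p n = G p n)"
  unfolding eq_iff by (intro oracle_computable_intros assms)

lemma oracle_computable_if [oracle_computable_intros]:
  assumes "oracle_decidable S P" "oracle_computable S F" "oracle_computable S G"
  shows "oracle_computable S (\<lambda>p n. if P p n then F p n else G p n)"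
proof -
  have "oracle_computable S (\<lambda>p n. of_bool (P p n) * F p n + of_bool (\<not> P p n) * G p n)"
    by (intro oracle_computable_intros assms)
  then show ?thesis by (rule oracle_computable_cong) auto
qed

lemma oracle_decidable_if [oracle_computable_intros]:
  assumes "oracle_decidable S P" "oracle_decidable S Q" "oracle_decidable S R"
  shows "oracle_decidable S (\<lambda>p n. if P p n then Q p n else R p n)"
  unfolding if_bool_eq_conj by (intro oracle_computable_intros assms)

lemma oracle_decidable_All_less [oracle_computable_intros]:
  assumes "oracle_computable S N" "oracle_decidable S (\<lambda>p z. P p (cfst z) (csnd z))"
  shows "oracle_decidable S (\<lambda>p n. \<forall>i<N p n. P p n i)"
proof -
  \<comment> \<open>Inside the recursion the predicate is called on codes of
    \<open>(n, (i, r))\<close> and ignores the accumulated product \<open>r\<close>.\<close>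
  have *: "oracle_decidable S (\<lambda>p z. P p (cfst z) (cfst (csnd z)))"
    using oracle_computable_comp[OF assms(2), of "\<lambda>p z. prod_encode (cfst z, cfst (csnd z))"]
    by (simp add: oracle_computable_intros)
  have "oracle_computable S (\<lambda>p n. rec_nat 1 (\<lambda>i r. r * of_bool (P p n i)) (N p n))"
    by (intro oracle_computable_intros assms *)
  moreover have "rec_nat 1 (\<lambda>i r. r * of_bool (Q i)) m = (of_bool (\<forall>i<m. Q i) :: nat)" for m Q
    by (induction m) (auto simp: less_Suc_eq)
  ultimately show ?thesis by simp
qed

lemma oracle_decidable_Ex_less [oracle_computable_intros]:
  assumes "oracle_computable S N" "oracle_decidable S (\<lambda>p z. P p (cfst z) (csnd z))"
  shows "oracle_decidable S (\<lambda>p n. \<exists>i<N p n. P p n i)"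
proof -
  have "oracle_decidable S (\<lambda>p n. \<not> (\<forall>i<N p n. \<not> P p n i))"
    by (intro oracle_computable_intros assms)
  then show ?thesis by simp
qed

lemma oracle_decidable_even [oracle_computable_intros]:
  assumes "oracle_computable S F"
  shows "oracle_decidable S (\<lambda>p n. even (F p n))"
proof -
  have "oracle_computable S (\<lambda>p n. rec_nat 1 (\<lambda>k r. 1 - r) (F p n))"
    by (intro oracle_computable_intros assms)
  moreover have "rec_nat 1 (\<lambda>k r. 1 - r) m = (of_bool (even m) :: nat)" for m
    by (induction m) auto
  ultimately show ?thesis by simp
qed

lemma oracle_computable_half [oracle_computable_intros]:
  assumes "oracle_computable S F"
  shows "oracle_computable S (\<lambda>p n. F p n div 2)"
proof -
  have "oracle_computable S (\<lambda>p n. rec_nat 0 (\<lambda>k r. if even k then r else Suc r) (F p n))"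
    by (intro oracle_computable_intros assms)
  moreover have "rec_nat 0 (\<lambda>k r. if even k then r else Suc r) m = m div 2" for m
    by (induction m) auto
  ultimately show ?thesis by simp
qed

lemma oracle_computable_Least [oracle_computable_intros]:
  assumes P: "oracle_decidable S (\<lambda>p z. P p (cfst z) (csnd z))"
    and ex: "\<And>p n. p \<in> S \<Longrightarrow> \<exists>k. P p n k"
  shows "oracle_computable S (\<lambda>p n. LEAST k. P p n k)"
proof -
  \<comment> \<open>\<open>PMu\<close> searches for a zero, and the program for the negation returns
    zero exactly where \<open>P\<close> holds.\<close>
  from oracle_decidable_not[OF P] obtain a
    where a: "\<And>p z. p \<in> S \<Longrightarrow> eval p a z (of_bool (\<not> P p (cfst z) (csnd z)))"
    unfolding oracle_computable_def by blast
  have "eval p (PMu a) n (LEAST k. P p n k)" if p: "p \<in> S" for p n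
  proof (rule eval_Mu)
    have "P p n (LEAST k. P p n k)" using ex[OF p] by (rule LeastI_ex)
    then show "eval p a (prod_encode (n, LEAST k. P p n k)) 0"
      using a[OF p, of "prod_encode (n, LEAST k. P p n k)"] by simp
    show "\<exists>r. eval p a (prod_encode (n, m)) (Suc r)" if "m < (LEAST k. P p n k)" for m
      using a[OF p, of "prod_encode (n, m)"] not_less_Least[OF that] by auto
  qed
  then show ?thesis by (rule oracle_computableI)
qed

section \<open>Change of oracle\<close>

primrec subst_oracle :: "prog \<Rightarrow> prog \<Rightarrow> prog" where
  "subst_oracle s PZero = PZero"
| "subst_oracle s PSucc = PSucc"
| "subst_oracle s PFst = PFst"
| "subst_oracle s PSnd = PSnd"
| "subst_oracle s POracle = s"
| "subst_oracle s (PPair a b) = PPair (subst_oracle s a) (subst_oracle s b)"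
| "subst_oracle s (PComp a b) = PComp (subst_oracle s a) (subst_oracle s b)"
| "subst_oracle s (PRec a b) = PRec (subst_oracle s a) (subst_oracle s b)"
| "subst_oracle s (PMu a) = PMu (subst_oracle s a)"

text \<open>Each oracle call is answered by running \<open>s\<close>. This composes a program with a
  preprocessing of its input.\<close>

lemma eval_subst_oracle:
  assumes "eval p' e n r" and s: "\<And>n. eval p s n (of_bool (p' n))"
  shows "eval p (subst_oracle s e) n r"
  using assms(1)
proof (induction rule: eval.induct)
  case (eval_Oracle n)
  show ?case using s by simp
next
  case (eval_Mu a n k)
  then show ?case by (auto intro!: eval.eval_Mu)
qed (auto intro: eval.intros)

text \<open>The program for \<open>f\<close> is known to work with the zero oracle only, so its
  oracle calls are replaced by \<open>PZero\<close>.\<close>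

lemma oracle_computable_computable_nat:
  assumes "computable_nat f" "oracle_computable S F"
  shows "oracle_computable S (\<lambda>p n. f (F p n))"
proof (rule oracle_computable_comp[of S "\<lambda>p. f", OF _ assms(2)])
  obtain e where e: "\<And>n. eval (\<lambda>_. False) e n (f n)"
    using assms(1) unfolding computable_nat_def by blast
  show "oracle_computable S (\<lambda>p. f)"
    by (intro oracle_computableI[of _ "subst_oracle PZero e"] eval_subst_oracle[OF e])
      (simp add: eval_Zero)
qed

section \<open>Evaluation with bounded resources\<close>

text \<open>
  The value \<open>0\<close> stands for an undefined result and \<open>Suc r\<close> for the result \<open>r\<close>; the same
  convention applies to the answers of the oracle \<open>u\<close>. The bound \<open>t\<close> limits the unbounded
  searches only. Their state is \<open>0\<close> while the search is running, \<open>1\<close> after an undefined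
  value, and \<open>k + 2\<close> once \<open>k\<close> has been found.
\<close>

primrec bounded_eval :: "prog \<Rightarrow> (nat \<Rightarrow> nat) \<Rightarrow> nat \<Rightarrow> nat \<Rightarrow> nat" where
  "bounded_eval PZero u t n = 1"
| "bounded_eval PSucc u t n = Suc (Suc n)"
| "bounded_eval PFst u t n = Suc (cfst n)"
| "bounded_eval PSnd u t n = Suc (csnd n)"
| "bounded_eval POracle u t n = u n"
| "bounded_eval (PPair a b) u t n =
    (if bounded_eval a u t n = 0 \<or> bounded_eval b u t n = 0 then 0
     else Suc (prod_encode (bounded_eval a u t n - 1, bounded_eval b u t n - 1)))"
| "bounded_eval (PComp a b) u t n =
    (if bounded_eval b u t n = 0 then 0 else bounded_eval a u t (bounded_eval b u t n - 1))"
| "bounded_eval (PRec a b) u t n =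
    rec_nat (bounded_eval a u t (cfst n))
      (\<lambda>k r. if r = 0 then 0
        else bounded_eval b u t (prod_encode (cfst n, prod_encode (k, r - 1)))) (csnd n)"
| "bounded_eval (PMu a) u t n =
    rec_nat 0 (\<lambda>k r. if r \<noteq> 0 then r
        else if bounded_eval a u t (prod_encode (n, k)) = 0 then 1
        else if bounded_eval a u t (prod_encode (n, k)) = 1 then Suc (Suc k)
        else 0) t - 1"

text \<open>The invariant of the search: running, aborted or finished. By the shifted convention,
  \<open>g m > 1\<close> means a nonzero result and \<open>g k = 1\<close> the result zero.\<close>

lemma bounded_search_cases:
  fixes g :: "nat \<Rightarrow> nat"
  defines "s \<equiv> rec_nat 0 (\<lambda>k r. if r \<noteq> 0 then r else if g k = 0 then 1
              else if g k = 1 then Suc (Suc k) else 0)"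
  shows "s t = 0 \<and> (\<forall>m<t. g m > 1) \<or> s t = 1 \<or>
    (\<exists>k<t. s t = Suc (Suc k) \<and> g k = 1 \<and> (\<forall>m<k. g m > 1))"
proof (induction t)
  case (Suc t)
  have "s (Suc t) = (if s t \<noteq> 0 then s t else if g t = 0 then 1
              else if g t = 1 then Suc (Suc t) else 0)"
    unfolding s_def by simp
  with Suc show ?case by (auto simp: less_Suc_eq)
qed (simp add: s_def)

text \<open>The state is 0 up to stage \<open>k\<close>, becomes \<open>k + 2\<close> at the next
  stage and is then frozen.\<close>

lemma bounded_search_found:
  fixes g :: "nat \<Rightarrow> nat"
  assumes "g k = 1" "\<And>m. m < k \<Longrightarrow> g m > 1" "k < t"
  shows "rec_nat 0 (\<lambda>k r. if r \<noteq> 0 then r else if g k = 0 then 1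
              else if g k = 1 then Suc (Suc k) else 0) t = Suc (Suc k)"
proof -
  let ?s = "rec_nat 0 (\<lambda>k r. if r \<noteq> 0 then r else if g k = 0 then 1
              else if g k = 1 then Suc (Suc k) else 0)"
  have s: "?s m = 0" if "m \<le> k" for m
    using that
  proof (induction m)
    case (Suc m)
    then show ?case using assms(2)[of m] by auto
  qed simp
  have "?s (Suc k + m) = Suc (Suc k)" for m
    by (induction m) (use s[of k] assms(1) in auto)
  from this[of "t - Suc k"] show ?thesis using assms(3) by simp
qed

text \<open>The oracle \<open>u\<close> may be silent but never wrong about \<open>p\<close>. Hence
  one finite run is valid for all oracles that agree with its answers.\<close>

lemma bounded_eval_sound:
  assumes "bounded_eval e u t n = Suc r" and u: "\<And>n b. u n = Suc b \<Longrightarrow> b = of_bool (p n)"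
  shows "eval p e n r"
  using assms(1)
proof (induction e arbitrary: n r)
  case (PRec a b)
  have "eval p (PRec a b) (prod_encode (x, k)) r"
    if "rec_nat (bounded_eval a u t x)
      (\<lambda>k r. if r = 0 then 0
        else bounded_eval b u t (prod_encode (x, prod_encode (k, r - 1)))) k = Suc r" for x k r
    using that
  proof (induction k arbitrary: r)
    case 0
    then show ?case using PRec.IH(1) by (auto intro: eval_Rec_0)
  next
    case (Suc k)
    then show ?case using PRec.IH(2)
      by (auto split: if_splits intro!: eval_Rec_Suc simp: gr0_conv_Suc)
  qed
  from this[of "cfst n" "csnd n" r] PRec.prems show ?case by simp
next
  case (PMu a)
  from bounded_search_cases[where t = t and g = "\<lambda>k. bounded_eval a u t (prod_encode (n, k))"]
    PMu.prems
  have "bounded_eval a u t (prod_encode (n, r)) = 1"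
    and m: "\<And>m. m < r \<Longrightarrow> bounded_eval a u t (prod_encode (n, m)) > 1"
    by auto
  then have "eval p a (prod_encode (n, r)) 0" by (intro PMu.IH) simp
  moreover have "\<exists>s. eval p a (prod_encode (n, m)) (Suc s)" if lt: "m < r" for m
  proof -
    have "bounded_eval a u t (prod_encode (n, m)) =
        Suc (Suc (bounded_eval a u t (prod_encode (n, m)) - 2))"
      using m[OF lt] by simp
    from PMu.IH[OF this] show ?thesis by (rule exI)
  qed
  ultimately show ?case by (rule eval_Mu)
next
  case (PPair a b)
  from PPair.prems obtain x y where "bounded_eval a u t n = Suc x" "bounded_eval b u t n = Suc y"
    and "r = prod_encode (x, y)"
    by (auto split: if_splits simp: gr0_conv_Suc)
  then show ?case using PPair.IH by (auto intro: eval_Pair)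
next
  case (PComp a b)
  from PComp.prems obtain m where "bounded_eval b u t n = Suc m" "bounded_eval a u t m = Suc r"
    by (auto split: if_splits simp: gr0_conv_Suc)
  then show ?case using PComp.IH by (blast intro: eval_Comp)
next
  case POracle
  then show ?case using u eval_Oracle[of p n] by simp
qed (auto intro: eval.intros)

text \<open>A derivation needs finitely many oracle answers and search steps, all available for
  large \<open>t\<close>. Working with \<open>eventually\<close> avoids explicit bounds.\<close>

lemma bounded_eval_complete:
  assumes "eval p e n r"
    and u: "\<And>n. eventually (\<lambda>t. u t n = Suc (of_bool (p n))) sequentially"
  shows "eventually (\<lambda>t. bounded_eval e (u t) t n = Suc r) sequentially"
  using assms(1)
proof (induction rule: eval.induct)
  case (eval_Oracle n)
  then show ?case using u by simp
next
  case (eval_Pair a n x b y)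
  from eval_Pair.IH show ?case by eventually_elim simp
next
  case (eval_Comp b n m a r)
  from eval_Comp.IH show ?case by eventually_elim simp
next
  case (eval_Rec_Suc a b n k r s)
  from eval_Rec_Suc.IH show ?case by eventually_elim (simp cong: if_cong)
next
  case (eval_Mu a n k)
  have "eventually (\<lambda>t. \<forall>m\<in>{..<k}. bounded_eval a (u t) t (prod_encode (n, m)) > 1) sequentially"
  proof (intro eventually_ball_finite ballI)
    fix m assume "m \<in> {..<k}"
    then obtain r where
      "eventually (\<lambda>t. bounded_eval a (u t) t (prod_encode (n, m)) = Suc (Suc r)) sequentially"
      using eval_Mu.IH(2) by auto
    then show "eventually (\<lambda>t. bounded_eval a (u t) t (prod_encode (n, m)) > 1) sequentially"
      by eventually_elim simp
  qed simp
  with eval_Mu.IH(1) eventually_gt_at_top[of k] show ?case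
  proof eventually_elim
    case (elim t)
    then show ?case
      using bounded_search_found[of "\<lambda>m. bounded_eval a (u t) t (prod_encode (n, m))" k t]
      by simp
  qed
qed simp_all

text \<open>Since \<open>e\<close> is fixed, induction on it takes the place of a universal
  machine.\<close>

lemma oracle_computable_bounded_eval:
  assumes u: "oracle_computable S (\<lambda>p z. u p (cfst z) (csnd z))"
    and t: "oracle_computable S (\<lambda>p n. t p n)" and N: "oracle_computable S N"
  shows "oracle_computable S (\<lambda>p n. bounded_eval e (u p n) (t p n) (N p n))"
proof -
  \<comment> \<open>Inside a recursion or search the argument becomes a code containing the original
    one; \<open>E\<close> recovers the argument on which \<open>u\<close> and \<open>t\<close>
    depend.\<close>
  have "oracle_computable S (\<lambda>p n. bounded_eval e (u p (E p n)) (t p (E p n)) (N p n))"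
    if "oracle_computable S E" "oracle_computable S N" for E N
    using that
  proof (induction e arbitrary: E N)
    case POracle
    from oracle_computable_comp[OF u oracle_computable_pair[OF POracle]] show ?case by simp
  next
    case (PRec a b)
    show ?case unfolding bounded_eval.simps
      by (intro oracle_computable_intros PRec
          oracle_computable_comp[OF PRec.prems(1)] oracle_computable_comp[OF PRec.prems(2)])
  next
    case (PMu a)
    show ?case unfolding bounded_eval.simps
      by (intro oracle_computable_intros PMu oracle_computable_comp[OF t]
          oracle_computable_comp[OF PMu.prems(1)] oracle_computable_comp[OF PMu.prems(2)])
  next
    case (PPair a b)
    show ?case unfolding bounded_eval.simps by (intro oracle_computable_intros PPair)
  next
    case (PComp a b)
    show ?case unfolding bounded_eval.simps by (intro oracle_computable_intros PComp)
  qed (simp_all add: oracle_computable_intros)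
  from this[OF oracle_computable_id N] show ?thesis .
qed


text \<open>Continuity of computation: a successful run with the oracle cut off at \<open>t\<close>
  is valid for every oracle with the same first \<open>t\<close> bits.\<close>

lemma eval_finite_use:
  assumes "eval p e n r"
  shows "\<exists>L. \<forall>p'. (\<forall>k<L. p' k = p k) \<longrightarrow> eval p' e n r"
proof -
  define u where "u t k = (if k < t then Suc (of_bool (p k)) else 0)" for t k :: nat
  have "eventually (\<lambda>t. u t k = Suc (of_bool (p k))) sequentially" for k
    using eventually_gt_at_top[of k] by eventually_elim (simp add: u_def)
  from bounded_eval_complete[of p e n r u, OF assms this]
  obtain t where t: "bounded_eval e (u t) t n = Suc r"
    by (auto simp: eventually_sequentially)
  show ?thesis
    by (intro exI[of _ t] allI impI bounded_eval_sound[OF t]) (auto simp: u_def split: if_splits)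
qed

section \<open>Names\<close>

text \<open>Iterated pairing makes every number code an infinite sequence. A finite word is an
  initial segment of one; its length is kept separately.\<close>

definition nth_code :: "nat \<Rightarrow> nat \<Rightarrow> nat" where
  "nth_code c k = cfst (rec_nat c (\<lambda>_ r. csnd r) k)"

lemma nth_code_prod_encode:
  "nth_code (prod_encode (x, c)) 0 = x"
  "nth_code (prod_encode (x, c)) (Suc k) = nth_code c k"
proof -
  have "rec_nat (prod_encode (x, c)) (\<lambda>_ r. csnd r) (Suc k) = rec_nat c (\<lambda>_ r. csnd r) k"
    by (induction k) auto
  then show "nth_code (prod_encode (x, c)) 0 = x"
    "nth_code (prod_encode (x, c)) (Suc k) = nth_code c k"
    by (simp_all only: nth_code_def) simp
qed

lemma ex_nth_code: "\<exists>c. \<forall>k<m. nth_code c k = u k"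
proof (induction m arbitrary: u)
  case (Suc m)
  obtain c where "\<forall>k<m. nth_code c k = u (Suc k)"
    using Suc[of "\<lambda>k. u (Suc k)"] by blast
  then have "\<forall>k<Suc m. nth_code (prod_encode (u 0, c)) k = u k"
    by (auto simp: less_Suc_eq_0_disj nth_code_prod_encode)
  then show ?case by blast
qed simp

lemma oracle_computable_nth_code [oracle_computable_intros]:
  assumes "oracle_computable S F" "oracle_computable S G"
  shows "oracle_computable S (\<lambda>p n. nth_code (F p n) (G p n))"
  unfolding nth_code_def by (intro oracle_computable_intros assms)

definition seq_name :: "(nat \<Rightarrow> nat) \<Rightarrow> cantor" where
  "seq_name u n \<longleftrightarrow> csnd n = u (cfst n)"

lemma tagged_zeros: "tagged n (\<lambda>_. False) k \<longleftrightarrow> k = n"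
  by (auto simp: tagged_def)

text \<open>Each number has a single name, hence so has each sequence: its graph.\<close>

lemma seq_rep_nat_rep_eq_Some_iff: "seq_rep nat_rep p = Some u \<longleftrightarrow> p = seq_name u"
proof
  assume "seq_rep nat_rep p = Some u"
  then have "nat_rep (proj p i) = Some (u i)" for i
    by (auto simp: seq_rep_def split: if_splits)
  then have "proj p i = tagged (u i) (\<lambda>_. False)" for i
    by (simp add: nat_rep_eq_Some_iff nat_name_def)
  then have "p (prod_encode (i, j)) \<longleftrightarrow> j = u i" for i j
    by (metis proj_def tagged_zeros)
  from this[of "cfst n" "csnd n" for n] show "p = seq_name u"
    by (auto simp: seq_name_def)
next
  assume "p = seq_name u"
  then have "proj p i = tagged (u i) (\<lambda>_. False)" for i
    by (auto simp: proj_def tagged_zeros seq_name_def)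
  then have "nat_rep (proj p i) = Some (u i)" for i
    by (simp add: nat_rep_eq_Some_iff nat_name_def)
  then show "seq_rep nat_rep p = Some u" by (simp add: seq_rep_def)
qed

text \<open>Removal of \<open>n\<close> thus shows in a single bit. The \<open>Suc\<close> is due to
  the value 0, which removes nothing.\<close>

lemma mem_closed_nat_rep_iff:
  assumes "closed_nat_rep z = Some N"
  shows "n \<in> N \<longleftrightarrow> (\<forall>a. \<not> z (prod_encode (a, Suc n)))"
proof -
  obtain u where "z = seq_name u" "N = {n. \<forall>k. u k \<noteq> Suc n}"
    using assms by (auto simp: closed_nat_rep_def seq_rep_nat_rep_eq_Some_iff)
  then show ?thesis by (auto simp: seq_name_def) metis
qed

lemma pfst_pair [simp]: "pfst (pair p q) = p"
  and psnd_pair [simp]: "psnd (pair p q) = q"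
  by (auto simp: pfst_def psnd_def pair_def)

lemma map_le_Some: "f \<subseteq>\<^sub>m g \<Longrightarrow> f a = Some b \<Longrightarrow> g a = Some b"
  unfolding map_le_def by (metis domI)

text \<open>The reduction works for all realizers of closed choice, so each correct answer can be
  tested with a realizer that gives it. The output of \<open>K\<close> does not depend on the
  realizer.\<close>

lemma weihrauch_le_closed_choice_nat:
  assumes "weihrauch_le \<delta>A \<delta>B (\<lambda>w. {f w}) closed_nat_rep nat_rep closed_choice_nat"
  shows "\<exists>eK eH. \<forall>p w. \<delta>A p = Some w \<longrightarrow> (\<exists>z N. outputs eK p z \<and> closed_nat_rep z = Some N \<and> N \<noteq> {} \<and>
      (\<forall>n\<in>N. \<exists>s. outputs eH (pair p (tagged n (\<lambda>_. False))) s \<and> \<delta>B s = Some (f w)))"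
proof -
  obtain H K where H: "computable H" and K: "computable K"
    and red: "\<And>G. realizes closed_nat_rep nat_rep closed_choice_nat G \<Longrightarrow>
           realizes \<delta>A \<delta>B (\<lambda>w. {f w})
             (\<lambda>p. Option.bind (K p) (\<lambda>r. Option.bind (G r) (\<lambda>s. H (pair p s))))"
    using assms unfolding weihrauch_le_def by blast
  obtain eH eK where eH: "H \<subseteq>\<^sub>m Phi eH" and eK: "K \<subseteq>\<^sub>m Phi eK"
    using H K unfolding computable_def by blast
  \<comment> \<open>\<open>G n\<close> answers \<open>n\<close> whenever that is correct and an
    arbitrary element otherwise.\<close>
  define G where "G n r = (case closed_nat_rep r of None \<Rightarrow> None | Some N \<Rightarrow>
      if N = {} then None
      else Some (tagged (if n \<in> N then n else (SOME m. m \<in> N)) (\<lambda>_. False)))" for n r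
  have "realizes closed_nat_rep nat_rep closed_choice_nat (G n)" for n
    unfolding realizes_def closed_choice_nat_def
    by (auto simp: G_def nat_rep_eq_Some_iff nat_name_def some_in_eq)
  note red = red[OF this]
  have "\<exists>z N. outputs eK p z \<and> closed_nat_rep z = Some N \<and> N \<noteq> {} \<and>
      (\<forall>n\<in>N. \<exists>s. outputs eH (pair p (tagged n (\<lambda>_. False))) s \<and> \<delta>B s = Some (f w))"
    if w: "\<delta>A p = Some w" for p w
  proof -
    have ex: "\<exists>z s s'. K p = Some z \<and> G n z = Some s \<and> H (pair p s) = Some s' \<and>
        \<delta>B s' = Some (f w)" for n
      using red[of n] w by (simp add: realizes_def bind_eq_Some_conv) blast
    then obtain z where z: "K p = Some z" by blast
    then obtain N where N: "closed_nat_rep z = Some N" "N \<noteq> {}"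
      using ex[of 0] by (auto simp: G_def split: option.splits if_splits)
    have "\<exists>s. outputs eH (pair p (tagged n (\<lambda>_. False))) s \<and> \<delta>B s = Some (f w)"
      if "n \<in> N" for n
    proof -
      have "G n z = Some (tagged n (\<lambda>_. False))" using N that by (simp add: G_def)
      with ex[of n] z obtain s where
        "H (pair p (tagged n (\<lambda>_. False))) = Some s" "\<delta>B s = Some (f w)" by auto
      then show ?thesis using eH by (metis map_le_Some Phi_eq_Some_iff)
    qed
    moreover have "outputs eK p z" using eK z by (metis map_le_Some Phi_eq_Some_iff)
    ultimately show ?thesis using N by blast
  qed
  then show ?thesis by blast
qed

text \<open>
  Names of functions receive a parameter of the form \<open>0\<^sup>i 1 q\<close> together with a name of
  the argument.
\<close>

definition seq_oracles :: "cantor set" where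
  "seq_oracles = {pair (tagged i q) (seq_name u) | i q u. True}"

text \<open>The even bits carry the tagged parameter: the first 1 among them marks the index, and
  the parameter proper starts one place later.\<close>

definition index_of :: "cantor \<Rightarrow> nat" where
  "index_of p = (LEAST k. p (2 * k))"

definition param_of :: "cantor \<Rightarrow> cantor" where
  "param_of p k = p (2 * Suc (index_of p + k))"

definition seq_of :: "cantor \<Rightarrow> nat \<Rightarrow> nat" where
  "seq_of p k = (LEAST b. p (Suc (2 * prod_encode (k, b))))"

lemma index_of_pair [simp]: "index_of (pair (tagged i q) r) = i"
  unfolding index_of_def by (rule Least_equality) (auto simp: pair_def tagged_def not_less[symmetric])

lemma param_of_pair [simp]: "param_of (pair (tagged i q) r) = q"
  by (rule ext) (simp add: param_of_def, simp add: pair_def tagged_def)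

lemma seq_of_pair [simp]: "seq_of (pair p (seq_name u)) = u"
  by (rule ext) (auto simp: seq_of_def pair_def seq_name_def intro: Least_equality)

lemma oracle_computable_index_of [oracle_computable_intros]:
  "oracle_computable seq_oracles (\<lambda>p n. index_of p)"
  unfolding index_of_def
proof (rule oracle_computable_Least)
  show "\<exists>k. p (2 * k)" if "p \<in> seq_oracles" for p
    using that by (auto simp: seq_oracles_def pair_def tagged_def)
qed (intro oracle_computable_intros)

lemma oracle_decidable_param_of [oracle_computable_intros]:
  assumes "oracle_computable seq_oracles F"
  shows "oracle_decidable seq_oracles (\<lambda>p n. param_of p (F p n))"
  unfolding param_of_def by (intro oracle_computable_intros assms)

lemma oracle_computable_seq_of [oracle_computable_intros]:
  assumes "oracle_computable seq_oracles F"
  shows "oracle_computable seq_oracles (\<lambda>p n. seq_of p (F p n))"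
  unfolding seq_of_def
proof (rule oracle_computable_Least)
  show "\<exists>b. p (Suc (2 * prod_encode (F p n, b)))" if "p \<in> seq_oracles" for p n
    using that by (auto simp: seq_oracles_def pair_def seq_name_def)
qed (intro oracle_computable_intros oracle_computable_comp[OF assms])

text \<open>Clearing denominators and moving negative terms across gives comparisons of natural
  numbers. The margin \<open>2 * (1/2) ^ J p n\<close> is there to absorb errors of approximated
  distances.\<close>

lemma oracle_decidable_rat_less:
  assumes "oracle_computable S C" "oracle_computable S I" "oracle_computable S J"
  shows "oracle_decidable S
    (\<lambda>p n. real_of_rat (rat_of_code (C p n)) + 2 * (1/2) ^ J p n < (1/2) ^ (I p n + 2))"
    and "oracle_decidable S
    (\<lambda>p n. (1/2) ^ (I p n + 2) + 2 * (1/2) ^ J p n < real_of_rat (rat_of_code (C p n)))"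
proof -
  have code: "real_of_rat (rat_of_code c) =
      (real (cfst c) - real (cfst (csnd c))) / real (Suc (csnd (csnd c)))" for c
    by (simp add: rat_of_code_def of_rat_divide of_rat_diff case_prod_beta of_rat_add)
  have 1: "real_of_rat (rat_of_code c) + 2 * (1/2) ^ j < (1/2) ^ (i + 2) \<longleftrightarrow>
      cfst c * 2 ^ j * 2 ^ (i + 2) + 2 * Suc (csnd (csnd c)) * 2 ^ (i + 2)
      < Suc (csnd (csnd c)) * 2 ^ j + cfst (csnd c) * 2 ^ j * 2 ^ (i + 2)" (is "?l \<longleftrightarrow> ?r")
    and 2: "(1/2) ^ (i + 2) + 2 * (1/2) ^ j < real_of_rat (rat_of_code c) \<longleftrightarrow>
      Suc (csnd (csnd c)) * 2 ^ j + 2 * Suc (csnd (csnd c)) * 2 ^ (i + 2)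
        + cfst (csnd c) * 2 ^ j * 2 ^ (i + 2)
      < cfst c * 2 ^ j * 2 ^ (i + 2)" (is "?l' \<longleftrightarrow> ?r'") for c i j
  proof -
    define k where "k = Suc (csnd (csnd c))"
    have pos: "real k * 2 ^ j * 2 ^ (i + 2) > 0" by (simp add: k_def)
    \<comment> \<open>\<open>T\<close> is a common denominator of all terms.\<close>
    define T where "T = real k * 2 ^ j * 2 ^ (i + 2)"
    have T: "T > 0" using pos by (simp add: T_def)
    have half: "(1/2 :: real) ^ m = 1 / 2 ^ m" for m by (simp add: power_divide)
    have a: "T * real_of_rat (rat_of_code c)
        = (real (cfst c) - real (cfst (csnd c))) * 2 ^ j * 2 ^ (i + 2)"
      unfolding code k_def[symmetric] T_def using pos by (simp add: k_def)
    have b: "T * (2 * (1/2) ^ j) = 2 * real k * 2 ^ (i + 2)"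
      and c: "T * (1/2) ^ (i + 2) = real k * 2 ^ j"
      unfolding T_def half by simp_all
    have "?l \<longleftrightarrow> T * (real_of_rat (rat_of_code c) + 2 * (1/2) ^ j) < T * (1/2) ^ (i + 2)"
      using T by (simp only: mult_less_cancel_left_pos)
    also have "\<dots> \<longleftrightarrow> real (cfst c * 2 ^ j * 2 ^ (i + 2) + 2 * k * 2 ^ (i + 2))
        < real (k * 2 ^ j + cfst (csnd c) * 2 ^ j * 2 ^ (i + 2))"
      unfolding distrib_left a b c by (simp add: algebra_simps)
    finally show "?l \<longleftrightarrow> ?r" unfolding of_nat_less_iff k_def .
    have "?l' \<longleftrightarrow> T * ((1/2) ^ (i + 2) + 2 * (1/2) ^ j) < T * real_of_rat (rat_of_code c)"
      using T by (simp only: mult_less_cancel_left_pos)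
    also have "\<dots> \<longleftrightarrow> real (k * 2 ^ j + 2 * k * 2 ^ (i + 2) + cfst (csnd c) * 2 ^ j * 2 ^ (i + 2))
        < real (cfst c * 2 ^ j * 2 ^ (i + 2))"
      unfolding distrib_left a b c by (simp add: algebra_simps)
    finally show "?l' \<longleftrightarrow> ?r'" unfolding of_nat_less_iff k_def .
  qed
  show "oracle_decidable S
    (\<lambda>p n. real_of_rat (rat_of_code (C p n)) + 2 * (1/2) ^ J p n < (1/2) ^ (I p n + 2))"
    unfolding 1 by (intro oracle_computable_intros assms)
  show "oracle_decidable S
    (\<lambda>p n. (1/2) ^ (I p n + 2) + 2 * (1/2) ^ J p n < real_of_rat (rat_of_code (C p n)))"
    unfolding 2 by (intro oracle_computable_intros assms)
qed

section \<open>The pieces\<close>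

context computable_metric_space
begin

lemma point_in [simp]: "\<alpha> k \<in> M"
  using points by auto

lemma ex_point_near:
  assumes "x \<in> M" "r > 0"
  shows "\<exists>k. d (\<alpha> k) x < r"
proof -
  have "x \<in> mtopology closure_of range \<alpha>" using assms dense by simp
  then obtain k where "\<alpha> k \<in> mball x r"
    using assms(2) unfolding metric_closure_of by blast
  then show ?thesis by (auto simp: commute)
qed

text \<open>Letting the later index tend to infinity bounds the distance to the limit.\<close>

lemma cauchy_repE:
  assumes "cauchy_rep M d \<alpha> r = Some x"
  obtains u where "r = seq_name u" "x \<in> M" "\<And>i. d (\<alpha> (u i)) x \<le> (1/2) ^ i"
proof -
  obtain u where r: "r = seq_name u"
    and u: "\<And>i j. i < j \<Longrightarrow> d (\<alpha> (u i)) (\<alpha> (u j)) \<le> (1/2) ^ i"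
    and lim: "limitin mtopology (\<lambda>i. \<alpha> (u i)) x sequentially"
    using assms by (auto simp: cauchy_rep_eq_Some_iff cauchy_name_def seq_rep_nat_rep_eq_Some_iff)
  have x: "x \<in> M" and lim: "(\<lambda>j. d (\<alpha> (u j)) x) \<longlonglongrightarrow> 0"
    using lim by (simp_all add: limitin_metric_dist_null)
  have "d (\<alpha> (u i)) x \<le> (1/2) ^ i" for i
  proof (rule LIMSEQ_le_const)
    show "(\<lambda>j. (1/2) ^ i + d (\<alpha> (u j)) x) \<longlonglongrightarrow> (1/2) ^ i"
      using tendsto_add[OF tendsto_const lim] by simp
    have "d (\<alpha> (u i)) x \<le> (1/2) ^ i + d (\<alpha> (u j)) x" if "i < j" for j
      using u[OF that] triangle[of "\<alpha> (u i)" "\<alpha> (u j)" x] x by simp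
    then show "\<exists>N. \<forall>j\<ge>N. d (\<alpha> (u i)) x \<le> (1/2) ^ i + d (\<alpha> (u j)) x"
      by (meson Suc_le_lessD)
  qed
  with r x show ?thesis by (rule that)
qed

lemma cauchy_rep_seq_nameI:
  assumes x: "x \<in> M" and u: "\<And>i. d (\<alpha> (u i)) x \<le> (1/2) ^ (i + 2)"
  shows "cauchy_rep M d \<alpha> (seq_name u) = Some x"
  unfolding cauchy_rep_eq_Some_iff cauchy_name_def
proof (intro exI[of _ u] conjI allI impI)
  show "seq_rep nat_rep (seq_name u) = Some u" by (simp add: seq_rep_nat_rep_eq_Some_iff)
  show "d (\<alpha> (u i)) (\<alpha> (u j)) \<le> (1/2) ^ i" if "i < j" for i j
  proof -
    have "d (\<alpha> (u i)) (\<alpha> (u j)) \<le> d (\<alpha> (u i)) x + d (\<alpha> (u j)) x"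
      using triangle[of "\<alpha> (u i)" x "\<alpha> (u j)"] x by (simp add: commute)
    also have "\<dots> \<le> (1/2) ^ (i + 2) + (1/2) ^ (j + 2)" using u by (intro add_mono)
    also have "(1/2) ^ (j + 2) \<le> (1/2 :: real) ^ (i + 2)"
      using that by (intro power_decreasing) auto
    also have "(1/2) ^ (i + 2) + (1/2) ^ (i + 2) \<le> (1/2 :: real) ^ i" by (simp add: power_add)
    finally show ?thesis by simp
  qed
  have "(\<lambda>i. (1/2 :: real) ^ (i + 2)) \<longlonglongrightarrow> 0"
    by (rule LIMSEQ_ignore_initial_segment) (simp add: LIMSEQ_power_zero)
  then have "(\<lambda>i. d (\<alpha> (u i)) x) \<longlonglongrightarrow> 0"
    by (rule tendsto_sandwich[OF _ _ tendsto_const, rotated 2]) (use u in \<open>auto intro!: eventuallyI\<close>)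
  then show "limitin mtopology (\<lambda>i. \<alpha> (u i)) x sequentially"
    using x by (simp add: limitin_metric_dist_null)
qed

text \<open>
  The index \<open>i = (n, (l, c))\<close> stands for the answer \<open>n\<close> of closed choice and the word
  of length \<open>l\<close> coded by \<open>c\<close>. Only sequences that approximate \<open>x\<close> four times better than
  necessary are considered: their conditions on the single entries are independent of
  each other, so that every word satisfying them can be continued to a name of \<open>x\<close>.
\<close>

definition extends :: "nat \<Rightarrow> 'a \<Rightarrow> (nat \<Rightarrow> nat) \<Rightarrow> bool" where
  "extends i x u \<longleftrightarrow> (\<forall>k<cfst (csnd i). u k = nth_code (csnd (csnd i)) k) \<and>
     (\<forall>k\<ge>cfst (csnd i). d (\<alpha> (u k)) x < (1/2) ^ (k + 2))"

text \<open>The word obeys a weak inequality, whose failure can be detected; the continuation in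
  \<open>extends\<close> obeys strict ones, whose validity can be detected. This makes the
  complement of a piece enumerable.\<close>

definition piece :: "prog \<Rightarrow> cantor \<Rightarrow> nat \<Rightarrow> 'a set" where
  "piece e q i = {x \<in> M.
     (\<forall>k<cfst (csnd i). d (\<alpha> (nth_code (csnd (csnd i)) k)) x \<le> (1/2) ^ (k + 2)) \<and>
     (\<forall>u. extends i x u \<longrightarrow>
        (\<forall>a. \<not> eval (pair (seq_name u) q) e (prod_encode (a, Suc (cfst i))) 1))}"

text \<open>The bounds complement each other: \<open>piece\<close> controls the word,
  \<open>extends\<close> the later entries.\<close>

lemma extends_cauchy_rep:
  assumes "x \<in> piece e q i" "extends i x u"
  shows "cauchy_rep M d \<alpha> (seq_name u) = Some x"
proof (rule cauchy_rep_seq_nameI)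
  show "d (\<alpha> (u k)) x \<le> (1/2) ^ (k + 2)" for k
    using assms unfolding extends_def piece_def
    by (cases "k < cfst (csnd i)") (simp, meson less_imp_le not_less)
qed (use assms in \<open>auto simp: piece_def\<close>)

text \<open>
  The sequences under consideration form a closed subset of Baire space, and
  the proof is the one of the Baire category theorem for this space.
\<close>

lemma pieces_cover:
  assumes x: "x \<in> M"
    and nonempty: "\<And>u. cauchy_rep M d \<alpha> (seq_name u) = Some x \<Longrightarrow>
      \<exists>n. \<forall>a. \<not> eval (pair (seq_name u) q) e (prod_encode (a, Suc n)) 1"
  shows "\<exists>i. x \<in> piece e q i"
proof (rule ccontr)
  assume no_piece: "\<nexists>i. x \<in> piece e q i"
  define good where "good u \<longleftrightarrow> (\<forall>k. d (\<alpha> (u k)) x < (1/2) ^ (k + 2))" for u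
  define removes where "removes u n \<longleftrightarrow>
    (\<exists>a. eval (pair (seq_name u) q) e (prod_encode (a, Suc n)) 1)" for u n
  have finite_use: "\<exists>L. \<forall>u'. (\<forall>k<L. u' k = u k) \<longrightarrow> removes u' n" if rem: "removes u n" for u n
  proof -
    obtain a where "eval (pair (seq_name u) q) e (prod_encode (a, Suc n)) 1"
      using rem unfolding removes_def by blast
    from eval_finite_use[OF this] obtain L where
      L: "\<And>p. \<forall>k<L. p k = pair (seq_name u) q k \<Longrightarrow> eval p e (prod_encode (a, Suc n)) 1"
      by blast
    have "removes u' n" if u': "\<forall>k<L. u' k = u k" for u'
      unfolding removes_def
    proof (rule exI, rule L, intro allI impI)
      fix k assume "k < L"
      \<comment> \<open>An even bit \<open>k\<close> depends on the entry
        \<open>cfst (k div 2)\<close> only, so agreement of the first \<open>L\<close> entries gives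
        agreement of the first \<open>L\<close> bits.\<close>
      moreover have "cfst (k div 2) \<le> k div 2"
        by (metis le_prod_encode_1 prod.collapse prod_decode_inverse)
      ultimately have "cfst (k div 2) < L" by linarith
      then show "pair (seq_name u') q k = pair (seq_name u) q k"
        using u' by (simp add: pair_def seq_name_def)
    qed
    then show ?thesis by blast
  qed
  \<comment> \<open>Density: the first \<open>l\<close> entries of \<open>u\<close> and the answer
    \<open>n\<close> index a piece. As \<open>x\<close> is not in it although the word is close to
    \<open>x\<close>, some continuation removes \<open>n\<close>.\<close>
  have step: "\<exists>u' l'. good u' \<and> l < l' \<and> (\<forall>k<l. u' k = u k) \<and>
      (\<forall>v. (\<forall>k<l'. v k = u' k) \<longrightarrow> removes v n)" if u: "good u" for u l n
  proof -
    obtain c where c: "\<forall>k<l. nth_code c k = u k" using ex_nth_code by blast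
    define i where "i = prod_encode (n, prod_encode (l, c))"
    have i: "cfst i = n" "cfst (csnd i) = l" "csnd (csnd i) = c" by (simp_all add: i_def)
    have "\<forall>k<l. d (\<alpha> (nth_code c k)) x \<le> (1/2) ^ (k + 2)"
      using c u unfolding good_def by (metis less_imp_le)
    moreover have "x \<notin> piece e q i" using no_piece by blast
    ultimately obtain u' where u': "extends i x u'" "removes u' n"
      using x unfolding piece_def i removes_def by blast
    have "d (\<alpha> (u' k)) x < (1/2) ^ (k + 2)" for k
      using u'(1) u c unfolding extends_def i good_def by (metis not_less)
    then have "good u'" by (simp add: good_def)
    moreover obtain L where "\<forall>v. (\<forall>k<L. v k = u' k) \<longrightarrow> removes v n"
      using finite_use[OF u'(2)] by blast
    then have "\<forall>v. (\<forall>k<max L (Suc l). v k = u' k) \<longrightarrow> removes v n"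
      by (metis less_max_iff_disj)
    moreover have "\<forall>k<l. u' k = u k" using u'(1) c unfolding extends_def i by simp
    moreover have "l < max L (Suc l)" by simp
    ultimately show ?thesis by blast
  qed
  have "\<exists>k. d (\<alpha> k) x < (1/2) ^ (m + 2)" for m :: nat by (rule ex_point_near[OF x]) simp
  then obtain u0 where u0: "good u0" unfolding good_def by metis
  \<comment> \<open>A state is a sequence with the length of its frozen prefix; passing from stage
    \<open>n\<close> to the next forces the removal of \<open>n\<close>.\<close>
  have "\<exists>s. \<forall>n. good (fst (s n)) \<and> (snd (s n) < snd (s (Suc n)) \<and>
      (\<forall>k<snd (s n). fst (s (Suc n)) k = fst (s n) k) \<and>
      (\<forall>v. (\<forall>k<snd (s (Suc n)). v k = fst (s (Suc n)) k) \<longrightarrow> removes v n))"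
  proof (rule dependent_nat_choice)
    show "\<exists>s :: (nat \<Rightarrow> nat) \<times> nat. good (fst s)" using u0 by (intro exI[of _ "(u0, 0)"]) simp
    show "\<exists>s'. good (fst s') \<and> (snd s < snd s' \<and> (\<forall>k<snd s. fst s' k = fst s k) \<and>
      (\<forall>v. (\<forall>k<snd s'. v k = fst s' k) \<longrightarrow> removes v n))" if "good (fst s)"
      for s :: "(nat \<Rightarrow> nat) \<times> nat" and n :: nat
      using step[OF that, of "snd s" n] by (metis fst_conv snd_conv)
  qed
  then obtain s where "\<forall>n. good (fst (s n)) \<and> (snd (s n) < snd (s (Suc n)) \<and>
      (\<forall>k<snd (s n). fst (s (Suc n)) k = fst (s n) k) \<and>
      (\<forall>v. (\<forall>k<snd (s (Suc n)). v k = fst (s (Suc n)) k) \<longrightarrow> removes v n))" ..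
  then have good: "\<And>n. good (fst (s n))"
    and mono: "\<And>n. snd (s n) < snd (s (Suc n))"
    and agree: "\<And>n k. k < snd (s n) \<Longrightarrow> fst (s (Suc n)) k = fst (s n) k"
    and removes: "\<And>n v. (\<And>k. k < snd (s (Suc n)) \<Longrightarrow> v k = fst (s (Suc n)) k) \<Longrightarrow> removes v n"
    by simp_all
  have smono: "strict_mono (\<lambda>n. snd (s n))" using mono by (simp add: strict_mono_Suc_iff)
  have agree': "fst (s m) k = fst (s n) k" if "n \<le> m" "k < snd (s n)" for m n k
    using that(1)
  proof (induction m rule: dec_induct)
    case (step m)
    have "snd (s n) \<le> snd (s m)" using strict_mono_less_eq[OF smono] step(1) by blast
    then show ?case using agree[of k m] step.IH that(2) by simp
  qed simp
  define u where "u k = fst (s (Suc k)) k" for k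
  have "u k = fst (s n) k" if "k < snd (s n)" for k n
  proof (cases "n \<le> Suc k")
    case True
    then show ?thesis using agree'[OF True that] by (simp add: u_def)
  next
    case False
    moreover have "k < snd (s (Suc k))"
      using strict_mono_imp_increasing[OF smono, of "Suc k"] by simp
    ultimately show ?thesis using agree'[of "Suc k" n k] by (simp add: u_def)
  qed
  then have "removes u n" for n using removes by blast
  moreover have "cauchy_rep M d \<alpha> (seq_name u) = Some x"
    using good x unfolding good_def u_def by (intro cauchy_rep_seq_nameI less_imp_le) auto
  ultimately show False using nonempty[of u] unfolding removes_def by blast
qed

lemma dist_approximation:
  obtains f where "computable_nat f"
    "\<And>a b j. \<bar>d (\<alpha> a) (\<alpha> b)
      - real_of_rat (rat_of_code (f (prod_encode (prod_encode (a, b), j))))\<bar> \<le> (1/2) ^ j"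
proof -
  obtain f where "computable_nat f" and
    f: "\<And>n j. \<bar>(case prod_decode n of (a, b) \<Rightarrow> d (\<alpha> a) (\<alpha> b))
      - real_of_rat (rat_of_code (f (prod_encode (n, j))))\<bar> \<le> (1/2) ^ j"
    using computable_dist unfolding computable_real_seq_def by blast
  show ?thesis
  proof (rule that)
    show "\<bar>d (\<alpha> a) (\<alpha> b)
      - real_of_rat (rat_of_code (f (prod_encode (prod_encode (a, b), j))))\<bar> \<le> (1/2) ^ j" for a b j
      using f[of "prod_encode (a, b)" j] by simp
  qed fact
qed

text \<open>
  A stage of the search consists of a word, a bound for its length and for the computation
  time, a precision for the distances, and a position in the enumeration.
\<close>

lemma complement_of_piece_program:
  "\<exists>e'. \<forall>i q u x. x \<in> M \<longrightarrow> (\<forall>k. d (\<alpha> (u k)) x \<le> (1/2) ^ k) \<longrightarrow>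
    (\<exists>z. outputs e' (pair (tagged i q) (seq_name u)) z \<and> ((\<exists>s. z s) \<longleftrightarrow> x \<notin> piece e q i))"
proof -
  obtain f where f: "computable_nat f"
    and approx: "\<And>a b j. \<bar>d (\<alpha> a) (\<alpha> b)
      - real_of_rat (rat_of_code (f (prod_encode (prod_encode (a, b), j))))\<bar> \<le> (1/2) ^ j"
    using dist_approximation by blast
  define D where "D a b j = real_of_rat (rat_of_code (f (prod_encode (prod_encode (a, b), j))))"
    for a b j
  \<comment> \<open>\<open>D\<close> errs by \<open>(1/2) ^ j\<close> through \<open>f\<close> and
    by \<open>(1/2) ^ j\<close> through using \<open>u j\<close> in place of \<open>x\<close>; the
    margin makes both tests sound.\<close>
  define far where "far a b k j \<longleftrightarrow> (1/2) ^ (k + 2) + 2 * (1/2) ^ j < D a b j" for a b k j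
  define close where "close a b k j \<longleftrightarrow> D a b j + 2 * (1/2) ^ j < (1/2) ^ (k + 2)" for a b k j
  \<comment> \<open>The simulated oracle knows \<open>q\<close> completely, but only the entries
    below \<open>t\<close> of the word followed by \<open>v\<close>.\<close>
  define answers where "answers i q v t m =
    (if even m then
       if cfst (m div 2) < t then
         Suc (of_bool (csnd (m div 2) =
           (if cfst (m div 2) < cfst (csnd i) then nth_code (csnd (csnd i)) (cfst (m div 2))
            else nth_code v (cfst (m div 2)))))
       else 0
     else Suc (of_bool (q (m div 2))))" for i q v t m
  \<comment> \<open>Either the word is too far from the point, or a continuation verified up to
    \<open>t\<close> removes the number. The value 2 encodes the output 1.\<close>
  define excluded where "excluded i q u v t j a \<longleftrightarrow>
     (\<exists>k<cfst (csnd i). far (nth_code (csnd (csnd i)) k) (u j) k j) \<or>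
     (\<forall>k<t. cfst (csnd i) \<le> k \<longrightarrow> close (nth_code v k) (u j) k j) \<and>
     bounded_eval e (answers i q v t) t (prod_encode (a, Suc (cfst i))) = 2"
    for i q u v t j a

  have "oracle_decidable seq_oracles (\<lambda>p s. excluded (index_of p) (param_of p) (seq_of p)
      (cfst s) (cfst (csnd s)) (cfst (csnd (csnd s))) (csnd (csnd (csnd s))))"
    unfolding excluded_def far_def close_def D_def answers_def
    by (intro oracle_computable_intros oracle_decidable_rat_less oracle_computable_bounded_eval
        oracle_computable_computable_nat[OF f])
  then obtain e' where e': "\<And>p n. p \<in> seq_oracles \<Longrightarrow> eval p e' n (of_bool
      (excluded (index_of p) (param_of p) (seq_of p)
        (cfst n) (cfst (csnd n)) (cfst (csnd (csnd n))) (csnd (csnd (csnd n)))))"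
    unfolding oracle_computable_def by blast

  show ?thesis
  proof (intro exI[of _ e'] allI impI)
    fix i q u x assume x: "x \<in> M" and "\<forall>k. d (\<alpha> (u k)) x \<le> (1/2) ^ k"
    then have u: "\<And>k. d (\<alpha> (u k)) x \<le> (1/2) ^ k" by blast
    have D: "\<bar>D a (u j) j - d (\<alpha> a) x\<bar> \<le> 2 * (1/2) ^ j" for a j
    proof -
      have "d (\<alpha> a) (\<alpha> (u j)) \<le> d (\<alpha> a) x + d (\<alpha> (u j)) x"
        using triangle[of "\<alpha> a" x "\<alpha> (u j)"] x by (simp add: commute)
      moreover have "d (\<alpha> a) x \<le> d (\<alpha> a) (\<alpha> (u j)) + d (\<alpha> (u j)) x"
        using triangle[of "\<alpha> a" "\<alpha> (u j)" x] x by simp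
      ultimately show ?thesis using approx[of a "u j" j] u[of j] unfolding D_def by linarith
    qed
    \<comment> \<open>The factor 4 collects the error of \<open>D\<close> and the margin, each
      \<open>2 * (1/2) ^ j\<close>.\<close>
    have small: "eventually (\<lambda>j. 4 * (1/2) ^ j < r) sequentially" if "r > 0" for r :: real
    proof -
      have "(\<lambda>j. 4 * (1/2 :: real) ^ j) \<longlonglongrightarrow> 4 * 0"
        by (intro tendsto_intros LIMSEQ_power_zero) simp
      then show ?thesis using that by (intro order_tendstoD(2)) simp_all
    qed
    have far_ev: "eventually (\<lambda>j. far a (u j) k j) sequentially"
      if "d (\<alpha> a) x > (1/2) ^ (k + 2)" for a k
    proof -
      have "d (\<alpha> a) x - (1/2) ^ (k + 2) > 0" using that by simp
      from small[OF this] show ?thesis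
      proof eventually_elim
        case (elim j)
        then show ?case using D[of a j] unfolding far_def by linarith
      qed
    qed
    have close_ev: "eventually (\<lambda>j. close a (u j) k j) sequentially"
      if "d (\<alpha> a) x < (1/2) ^ (k + 2)" for a k
    proof -
      have "(1/2) ^ (k + 2) - d (\<alpha> a) x > 0" using that by simp
      from small[OF this] show ?thesis
      proof eventually_elim
        case (elim j)
        then show ?case using D[of a j] unfolding close_def by linarith
      qed
    qed
    have farD: "d (\<alpha> a) x > (1/2) ^ (k + 2)" if "far a (u j) k j" for a k j
      using that D[of a j] unfolding far_def by linarith
    have closeD: "d (\<alpha> a) x < (1/2) ^ (k + 2)" if "close a (u j) k j" for a k j
      using that D[of a j] unfolding close_def by linarith

    have sound: "x \<notin> piece e q i" if ex: "excluded i q u v t j a" for v t j a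
    proof (cases "\<exists>k<cfst (csnd i). far (nth_code (csnd (csnd i)) k) (u j) k j")
      case True
      then obtain k where "k < cfst (csnd i)" "d (\<alpha> (nth_code (csnd (csnd i)) k)) x > (1/2) ^ (k + 2)"
        using farD by blast
      then show ?thesis unfolding piece_def by (auto simp: not_le[symmetric] simp del: power_Suc)
    next
      case False
      then have close: "\<And>k. k < t \<Longrightarrow> cfst (csnd i) \<le> k \<Longrightarrow> close (nth_code v k) (u j) k j"
        and eval: "bounded_eval e (answers i q v t) t (prod_encode (a, Suc (cfst i))) = Suc 1"
        using ex unfolding excluded_def by auto
      \<comment> \<open>The run has not seen entries from \<open>t\<close> on, so any points close
        enough to \<open>x\<close> may complete the word.\<close>
      have "\<exists>m. d (\<alpha> m) x < (1/2) ^ (k + 2)" for k :: nat by (rule ex_point_near[OF x]) simp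
      then obtain w where w: "\<And>k. d (\<alpha> (w k)) x < (1/2) ^ (k + 2)" by metis
      define u' where "u' k = (if k < cfst (csnd i) then nth_code (csnd (csnd i)) k
        else if k < t then nth_code v k else w k)" for k
      have "extends i x u'"
        unfolding extends_def u'_def using closeD[OF close] w by auto
      moreover have "eval (pair (seq_name u') q) e (prod_encode (a, Suc (cfst i))) 1"
        by (rule bounded_eval_sound[OF eval])
          (auto simp: answers_def pair_def seq_name_def u'_def split: if_splits)
      ultimately show ?thesis unfolding piece_def by blast
    qed
    have complete: "\<exists>v t j a. excluded i q u v t j a" if out: "x \<notin> piece e q i"
    proof (cases "\<exists>k<cfst (csnd i). d (\<alpha> (nth_code (csnd (csnd i)) k)) x > (1/2) ^ (k + 2)")
      case True
      then obtain k where k: "k < cfst (csnd i)" and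
        far: "d (\<alpha> (nth_code (csnd (csnd i)) k)) x > (1/2) ^ (k + 2)" by blast
      obtain j where "far (nth_code (csnd (csnd i)) k) (u j) k j"
        using far_ev[OF far] unfolding eventually_sequentially by blast
      then show ?thesis using k unfolding excluded_def by blast
    next
      case False
      then obtain u' a where u': "extends i x u'"
        and eval: "eval (pair (seq_name u') q) e (prod_encode (a, Suc (cfst i))) 1"
        using out x unfolding piece_def not_less[symmetric] by blast
      obtain v where v: "\<And>t k. k < t \<Longrightarrow> nth_code (v t) k = u' k"
        using ex_nth_code[of _ u'] by metis
      have "eventually (\<lambda>t. answers i q (v t) t m = Suc (of_bool (pair (seq_name u') q m)))
          sequentially" for m
        using eventually_gt_at_top[of "cfst (m div 2)"]
      proof eventually_elim
        case (elim t)
        then show ?case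
          using u' v[OF elim] by (auto simp: answers_def pair_def seq_name_def extends_def)
      qed
      from bounded_eval_complete[OF eval this] obtain t where
        t: "bounded_eval e (answers i q (v t) t) t (prod_encode (a, Suc (cfst i))) = 2"
        unfolding eventually_sequentially by (auto simp: numeral_2_eq_2)
      \<comment> \<open>With \<open>t\<close> fixed, only finitely many entries need verification,
        so one precision \<open>j\<close> suffices.\<close>
      have "eventually (\<lambda>j. \<forall>k\<in>{cfst (csnd i)..<t}. close (nth_code (v t) k) (u j) k j) sequentially"
        using u' v by (intro eventually_ball_finite ballI close_ev) (auto simp: extends_def)
      then obtain j where
        "\<forall>k\<in>{cfst (csnd i)..<t}. close (nth_code (v t) k) (u j) k j"
        unfolding eventually_sequentially by blast
      with t have "excluded i q u (v t) t j a" unfolding excluded_def by auto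
      then show ?thesis by blast
    qed

    let ?p = "pair (tagged i q) (seq_name u)"
    let ?z = "\<lambda>s. excluded i q u (cfst s) (cfst (csnd s)) (cfst (csnd (csnd s))) (csnd (csnd (csnd s)))"
    have "?p \<in> seq_oracles" by (auto simp: seq_oracles_def)
    from e'[OF this] have "outputs e' ?p ?z" by (simp add: outputs_def)
    moreover have "(\<exists>s. ?z s) \<longleftrightarrow> x \<notin> piece e q i"
    proof
      assume "x \<notin> piece e q i"
      then obtain v t j a where "excluded i q u v t j a" using complete by blast
      then have "?z (prod_encode (v, prod_encode (t, prod_encode (j, a))))" by simp
      then show "\<exists>s. ?z s" ..
    qed (use sound in blast)
    ultimately show "\<exists>z. outputs e' ?p z \<and> ((\<exists>s. z s) \<longleftrightarrow> x \<notin> piece e q i)" by blast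
  qed
qed

end

section \<open>Evaluation on a piece\<close>

definition continuation :: "nat \<Rightarrow> (nat \<Rightarrow> nat) \<Rightarrow> nat \<Rightarrow> nat" where
  "continuation i u k =
     (if k < cfst (csnd i) then nth_code (csnd (csnd i)) k else u (k + 3))"

text \<open>The shift by three turns the weak bound of a name into the strict bound
  \<open>(1/2) ^ (k + 2)\<close>.\<close>

lemma (in computable_metric_space) extends_continuation:
  assumes "\<And>k. d (\<alpha> (u k)) x \<le> (1/2) ^ k"
  shows "extends i x (continuation i u)"
proof -
  have "d (\<alpha> (u (k + 3))) x < (1/2) ^ (k + 2)" for k
    by (rule order_le_less_trans[OF assms]) (simp add: power_add power3_eq_cube)
  then show ?thesis by (simp add: extends_def continuation_def)
qed

text \<open>The oracle of \<open>e\<close> is replaced by a program that computes the modified name,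
  the parameter and the name of the answer bit by bit.\<close>

lemma evaluation_program:
  "\<exists>e'. \<forall>i q u s.
    outputs e (pair (pair (seq_name (continuation i u)) q) (tagged (cfst i) (\<lambda>_. False))) s \<longrightarrow>
    outputs e' (pair (tagged i q) (seq_name u)) s"
proof -
  have "oracle_decidable seq_oracles (\<lambda>p m.
      if even m then
        if even (m div 2) then
          csnd (m div 2 div 2) = continuation (index_of p) (seq_of p) (cfst (m div 2 div 2))
        else param_of p (m div 2 div 2)
      else m div 2 = cfst (index_of p))"
    unfolding continuation_def by (intro oracle_computable_intros)
  then obtain b where b: "\<And>p m. p \<in> seq_oracles \<Longrightarrow> eval p b m (of_bool (
      if even m then
        if even (m div 2) then
          csnd (m div 2 div 2) = continuation (index_of p) (seq_of p) (cfst (m div 2 div 2))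
        else param_of p (m div 2 div 2)
      else m div 2 = cfst (index_of p)))"
    unfolding oracle_computable_def by blast
  show ?thesis
  proof (intro exI[of _ "subst_oracle b e"] allI impI)
    fix i q u s
    let ?p = "pair (tagged i q) (seq_name u)"
    let ?p' = "pair (pair (seq_name (continuation i u)) q) (tagged (cfst i) (\<lambda>_. False))"
    assume s: "outputs e ?p' s"
    have "?p \<in> seq_oracles" by (auto simp: seq_oracles_def)
    note b = b[OF this, unfolded index_of_pair param_of_pair seq_of_pair]
    have "?p' m \<longleftrightarrow>
      (if even m then
        if even (m div 2) then csnd (m div 2 div 2) = continuation i u (cfst (m div 2 div 2))
        else q (m div 2 div 2)
      else m div 2 = cfst i)" for m
      by (simp add: pair_def seq_name_def tagged_zeros)
    then have "eval ?p b m (of_bool (?p' m))" for m using b[of m] by (simp only:)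
    then show "outputs (subst_oracle b e) ?p s"
      using s eval_subst_oracle unfolding outputs_def by blast
  qed
qed

section \<open>Assembling the name\<close>

lemma fun_rep_taggedI:
  assumes "\<And>r x. \<delta>A r = Some x \<Longrightarrow> \<exists>z. outputs e (pair q r) z \<and> \<delta>B z = Some (g x)"
    and "g \<in> extensional (ran \<delta>A)"
  shows "fun_rep \<delta>A \<delta>B (tagged (prog_code e) q) = Some g"
  unfolding fun_rep_eq_Some_iff fun_name_def
proof (intro conjI exI)
  have "g x \<in> ran \<delta>B" if "x \<in> ran \<delta>A" for x
    using that assms(1) unfolding ran_def by blast
  then show "g \<in> ran \<delta>A \<rightarrow>\<^sub>E ran \<delta>B"
    using assms(2) by (simp add: PiE_iff)
  show "realizes \<delta>A \<delta>B (\<lambda>x. {g x}) (\<lambda>r. Phi e (pair q r))"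
    using assms(1) by (auto simp: realizes_def Phi_eq_Some_iff)
qed (rule refl)

text \<open>A 1 in the output certifies membership in the complement, as Sierpinski space
  requires.\<close>

lemma closed_rep_taggedI:
  assumes "\<And>r x. \<delta> r = Some x \<Longrightarrow> \<exists>z. outputs e (pair q r) z \<and> ((\<exists>n. z n) \<longleftrightarrow> x \<notin> A)"
    and "A \<subseteq> ran \<delta>"
  shows "closed_rep \<delta> (tagged (prog_code e) q) = Some A"
proof -
  have "fun_rep \<delta> sierpinski_rep (tagged (prog_code e) q) = Some (\<lambda>x\<in>ran \<delta>. x \<notin> A)"
  proof (rule fun_rep_taggedI)
    fix r x assume r: "\<delta> r = Some x"
    then have "x \<in> ran \<delta>" by (auto simp: ran_def)
    then show "\<exists>z. outputs e (pair q r) z \<and> sierpinski_rep z = Some ((\<lambda>x\<in>ran \<delta>. x \<notin> A) x)"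
      using assms(1)[OF r] by (simp add: sierpinski_rep_def)
  qed simp
  then show ?thesis using assms(2) by (auto simp: closed_rep_def open_rep_def)
qed

lemma sub_rep_eq_Some_iff: "sub_rep \<delta> A p = Some x \<longleftrightarrow> \<delta> p = Some x \<and> x \<in> A"
  by (auto simp: sub_rep_def bind_eq_Some_conv)

lemma ran_sub_rep: "A \<subseteq> ran \<delta> \<Longrightarrow> ran (sub_rep \<delta> A) = A"
  by (auto simp: ran_def sub_rep_eq_Some_iff)

text \<open>The codes \<open>a\<close> and \<open>b\<close> are constants; only the parameter, made
  of the index and \<open>q\<close>, varies over the sequence.\<close>

lemma piecewise_name_program:
  "\<exists>e. \<forall>q. outputs e q (\<lambda>n. pair (tagged a (tagged (cfst n) q)) (tagged b (tagged (cfst n) q)) (csnd n))"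
proof -
  have "oracle_decidable UNIV
      (\<lambda>q n. pair (tagged a (tagged (cfst n) q)) (tagged b (tagged (cfst n) q)) (csnd n))"
    unfolding pair_def tagged_def by (intro oracle_computable_intros)
  then show ?thesis unfolding oracle_computable_def outputs_def by simp
qed

theorem theorem9:
  fixes X :: "'x set" and dX :: "'x \<Rightarrow> 'x \<Rightarrow> real" and \<alpha>X :: "nat \<Rightarrow> 'x"
    and Z :: "'z set" and dZ :: "'z \<Rightarrow> 'z \<Rightarrow> real" and \<alpha>Z :: "nat \<Rightarrow> 'z"
    and \<delta>Y :: "'y repr"
    and f :: "'x \<times> 'y \<Rightarrow> 'z"
  assumes "computable_metric_space X dX \<alpha>X"
    and "computable_metric_space Z dZ \<alpha>Z"
    and "f \<in> X \<times> ran \<delta>Y \<rightarrow> Z"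
    and "weihrauch_le (prod_rep (cauchy_rep X dX \<alpha>X) \<delta>Y) (cauchy_rep Z dZ \<alpha>Z) (\<lambda>w. {f w})
           closed_nat_rep nat_rep closed_choice_nat"
  shows "computable_map \<delta>Y (piecewise_rep (cauchy_rep X dX \<alpha>X) (cauchy_rep Z dZ \<alpha>Z))
           (\<lambda>y. \<lambda>x\<in>X. f (x, y))"
proof -
  interpret X: computable_metric_space X dX \<alpha>X by (rule assms(1))
  interpret Z: computable_metric_space Z dZ \<alpha>Z by (rule assms(2))
  let ?\<delta>X = "cauchy_rep X dX \<alpha>X" and ?\<delta>Z = "cauchy_rep Z dZ \<alpha>Z"
  obtain eK eH where
    red: "\<forall>p w. prod_rep ?\<delta>X \<delta>Y p = Some w \<longrightarrow>
      (\<exists>z N. outputs eK p z \<and> closed_nat_rep z = Some N \<and> N \<noteq> {} \<and>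
      (\<forall>n\<in>N. \<exists>s. outputs eH (pair p (tagged n (\<lambda>_. False))) s \<and> ?\<delta>Z s = Some (f w)))"
    using weihrauch_le_closed_choice_nat[OF assms(4)] by blast
  \<comment> \<open>Correct answers are described by bits never set in the output of
    \<open>eK\<close>, matching the definition of \<open>piece\<close>.\<close>
  have choice: "\<exists>n. \<forall>a. \<not> eval (pair r q) eK (prod_encode (a, Suc n)) 1"
    and result: "(\<forall>a. \<not> eval (pair r q) eK (prod_encode (a, Suc n)) 1) \<Longrightarrow>
      \<exists>s. outputs eH (pair (pair r q) (tagged n (\<lambda>_. False))) s \<and> ?\<delta>Z s = Some (f (x, y))"
    if rq: "?\<delta>X r = Some x" "\<delta>Y q = Some y" for r q x y n
  proof -
    have "prod_rep ?\<delta>X \<delta>Y (pair r q) = Some (x, y)" using rq by (simp add: prod_rep_def)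
    note red[rule_format, OF this]
    then obtain z N where z: "outputs eK (pair r q) z" and N: "closed_nat_rep z = Some N" "N \<noteq> {}"
      and H: "\<forall>n\<in>N. \<exists>s. outputs eH (pair (pair r q) (tagged n (\<lambda>_. False))) s \<and>
        ?\<delta>Z s = Some (f (x, y))"
      by (elim exE conjE)
    have "eval (pair r q) eK m 1 \<longleftrightarrow> z m" for m
    proof
      assume "eval (pair r q) eK m 1"
      moreover have "eval (pair r q) eK m (of_bool (z m))" using z by (simp add: outputs_def)
      ultimately have "of_bool (z m) = (1 :: nat)" by (metis eval_unique)
      then show "z m" by (simp split: if_splits add: of_bool_def)
    next
      assume "z m"
      then show "eval (pair r q) eK m 1" using z unfolding outputs_def by (metis of_bool_eq(2))
    qed
    then have mem: "n \<in> N \<longleftrightarrow> (\<forall>a. \<not> eval (pair r q) eK (prod_encode (a, Suc n)) 1)" for n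
      using mem_closed_nat_rep_iff[OF N(1)] by simp
    show "\<exists>n. \<forall>a. \<not> eval (pair r q) eK (prod_encode (a, Suc n)) 1"
      using N(2) mem by blast
    show "\<exists>s. outputs eH (pair (pair r q) (tagged n (\<lambda>_. False))) s \<and> ?\<delta>Z s = Some (f (x, y))"
      if "\<forall>a. \<not> eval (pair r q) eK (prod_encode (a, Suc n)) 1"
      using H mem[of n] that by simp
  qed
  obtain e\<^sub>A where e\<^sub>A: "\<forall>i q u x. x \<in> X \<longrightarrow> (\<forall>k. dX (\<alpha>X (u k)) x \<le> (1/2) ^ k) \<longrightarrow>
    (\<exists>z. outputs e\<^sub>A (pair (tagged i q) (seq_name u)) z \<and> ((\<exists>s. z s) \<longleftrightarrow> x \<notin> X.piece eK q i))"
    using X.complement_of_piece_program[of eK] by blast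
  obtain e\<^sub>g where e\<^sub>g: "\<forall>i q u s.
    outputs eH (pair (pair (seq_name (continuation i u)) q) (tagged (cfst i) (\<lambda>_. False))) s \<longrightarrow>
    outputs e\<^sub>g (pair (tagged i q) (seq_name u)) s"
    using evaluation_program[of eH] by blast
  obtain e where e: "\<forall>q. outputs e q (\<lambda>n. pair (tagged (prog_code e\<^sub>A) (tagged (cfst n) q))
      (tagged (prog_code e\<^sub>g) (tagged (cfst n) q)) (csnd n))"
    using piecewise_name_program[of "prog_code e\<^sub>A" "prog_code e\<^sub>g"] by blast
  have "realizes \<delta>Y (piecewise_rep ?\<delta>X ?\<delta>Z) (\<lambda>y. {\<lambda>x\<in>X. f (x, y)}) (Phi e)"
    unfolding realizes_def
  proof (intro allI impI, elim conjE)
    fix q y assume q: "\<delta>Y q = Some y"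
    define out where "out n = pair (tagged (prog_code e\<^sub>A) (tagged (cfst n) q))
      (tagged (prog_code e\<^sub>g) (tagged (cfst n) q)) (csnd n)" for n
    let ?A = "X.piece eK q"
    let ?g = "\<lambda>x\<in>X. f (x, y)"
    have proj: "proj out i = pair (tagged (prog_code e\<^sub>A) (tagged i q))
      (tagged (prog_code e\<^sub>g) (tagged i q))" for i
      by (rule ext) (simp add: proj_def out_def)
    have A_sub: "?A i \<subseteq> X" for i by (auto simp: X.piece_def)
    have "piecewise_name ?\<delta>X ?\<delta>Z out ?g"
      unfolding piecewise_name_def X.ran_cauchy_rep Z.ran_cauchy_rep proj pfst_pair psnd_pair
    proof (intro conjI exI allI)
      have "y \<in> ran \<delta>Y" using q by (auto simp: ran_def)
      then show "?g \<in> X \<rightarrow>\<^sub>E Z" using assms(3) by auto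
      show "closed_rep ?\<delta>X (tagged (prog_code e\<^sub>A) (tagged i q)) = Some (?A i)" for i
      proof (rule closed_rep_taggedI)
        show "\<exists>z. outputs e\<^sub>A (pair (tagged i q) r) z \<and> ((\<exists>n. z n) \<longleftrightarrow> x \<notin> ?A i)"
          if r: "?\<delta>X r = Some x" for r x
          using r e\<^sub>A by (elim X.cauchy_repE) simp
      qed (simp add: X.ran_cauchy_rep A_sub)
      show "fun_rep (sub_rep ?\<delta>X (?A i)) ?\<delta>Z (tagged (prog_code e\<^sub>g) (tagged i q)) =
          Some (restrict ?g (?A i))" for i
      proof (rule fun_rep_taggedI)
        fix r x assume "sub_rep ?\<delta>X (?A i) r = Some x"
        then have r: "?\<delta>X r = Some x" and x: "x \<in> ?A i" by (simp_all add: sub_rep_eq_Some_iff)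
        from r obtain u where u: "r = seq_name u" "\<And>k. dX (\<alpha>X (u k)) x \<le> (1/2) ^ k"
          by (elim X.cauchy_repE) blast
        \<comment> \<open>The given name need not begin with the word, so it is replaced by one that
          does.\<close>
        note ext = X.extends_continuation[OF u(2), of i]
        have "\<forall>a. \<not> eval (pair (seq_name (continuation i u)) q) eK (prod_encode (a, Suc (cfst i))) 1"
          using x ext unfolding X.piece_def by blast
        from result[OF X.extends_cauchy_rep[OF x ext] q this] obtain s where s:
          "outputs eH (pair (pair (seq_name (continuation i u)) q) (tagged (cfst i) (\<lambda>_. False))) s"
          "?\<delta>Z s = Some (f (x, y))"
          by blast
        have "outputs e\<^sub>g (pair (tagged i q) r) s"
          unfolding u(1) by (rule e\<^sub>g[rule_format, OF s(1)])
        moreover have "restrict ?g (?A i) x = f (x, y)" using x A_sub[of i] by auto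
        ultimately show
          "\<exists>z. outputs e\<^sub>g (pair (tagged i q) r) z \<and> ?\<delta>Z z = Some (restrict ?g (?A i) x)"
          using s(2) by auto
      qed (simp only: ran_sub_rep X.ran_cauchy_rep A_sub restrict_extensional)
      \<comment> \<open>Every name of \<open>x\<close> leaves some number unremoved, which is what
        the category argument requires.\<close>
      have "\<exists>i. x \<in> ?A i" if "x \<in> X" for x
        using X.pieces_cover[OF that] choice q by blast
      then show "X = (\<Union>i. ?A i)" using A_sub by blast
    qed simp
    then have "piecewise_rep ?\<delta>X ?\<delta>Z out = Some ?g" by (simp add: piecewise_rep_eq_Some_iff)
    moreover have "Phi e q = Some out"
      using e[rule_format, of q] unfolding Phi_eq_Some_iff out_def .
    ultimately show "\<exists>p z. Phi e q = Some p \<and> piecewise_rep ?\<delta>X ?\<delta>Z p = Some z \<and> z \<in> {?g}"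
      by blast
  qed
  then show ?thesis unfolding computable_map_def computable_def by (auto intro: map_le_refl)
qed

end
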